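(* Let $\bullet\in\{*,\mathrm{sh}\}$, let $n\in\{2,3,4\}$, let $\mathbf l=(l_1,\dots,l_n)\in\mathbb N^n$ and $L=l_1+\dots+l_n$. Then \[ \zeta^\bullet_2(l_1,l_2)+\zeta^\bullet_2(l_2,l_1)=\zeta^\bullet_1(l_1)\zeta^\bullet_1(l_2)-\chi^\bullet_2(l_1,l_2)\,\zeta(L)\qquad(n=2), \] \[ \begin{aligned} &\zeta^\bullet_3(l_1,l_2,l_3)+\zeta^\bullet_3(l_2,l_3,l_1)+\zeta^\bullet_3(l_3,l_1,l_2)\\ &=-\zeta^\bullet_1(l_1)\zeta^\bullet_1(l_2)\zeta^\bullet_1(l_3)+\zeta^\bullet_2(l_1,l_2)\zeta^\bullet_1(l_3)+\zeta^\bullet_2(l_2,l_3)\zeta^\bullet_1(l_1)+\zeta^\bullet_2(l_3,l_1)\zeta^\bullet_1(l_2)+\chi^\bullet_3(\mathbf l)\,\zeta(L)\qquad(n=3), \end{aligned} \] \[ \begin{aligned} &\zeta^\bullet_4(l_1,l_2,l_3,l_4)+\zeta^\bullet_4(l_2,l_3,l_4,l_1)+\zeta^\bullet_4(l_3,l_4,l_1,l_2)+\zeta^\bullet_4(l_4,l_1,l_2,l_3)\\ &=\zeta^\bullet_1(l_1)\zeta^\bullet_1(l_2)\zeta^\bullet_1(l_3)\zeta^\bullet_1(l_4)\\ &\quad-\zeta^\bullet_2(l_1,l_2)\zeta^\bullet_1(l_3)\zeta^\bullet_1(l_4)-\zeta^\bullet_2(l_2,l_3)\zeta^\bullet_1(l_4)\zeta^\bullet_1(l_1)-\zeta^\bullet_2(l_3,l_4)\zeta^\bullet_1(l_1)\zeta^\bullet_1(l_2)-\zeta^\bullet_2(l_4,l_1)\zeta^\bullet_1(l_2)\zeta^\bullet_1(l_3)\\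 &\quad+\zeta^\bullet_2(l_1,l_2)\zeta^\bullet_2(l_3,l_4)+\zeta^\bullet_2(l_2,l_3)\zeta^\bullet_2(l_4,l_1)\\ &\quad+\zeta^\bullet_3(l_1,l_2,l_3)\zeta^\bullet_1(l_4)+\zeta^\bullet_3(l_2,l_3,l_4)\zeta^\bullet_1(l_1)+\zeta^\bullet_3(l_3,l_4,l_1)\zeta^\bullet_1(l_2)+\zeta^\bullet_3(l_4,l_1,l_2)\zeta^\bullet_1(l_3)\\ &\quad-\chi^\bullet_4(\mathbf l)\,\zeta(L)\qquad(n=4). \end{aligned} \]
   Context: $\mathbb N=\{1,2,3,\dots\}$. For $\mathbf l=(l_1,\dots,l_n)\in\mathbb N^n$ with $l_1\ge2$ the multiple zeta value is $\zeta_n(\mathbf l)=\sum_{m_1>\dots>m_n>0}m_1^{-l_1}\cdots m_n^{-l_n}$, and $\zeta(k)=\zeta_1(k)$ for $k\ge2$. Regularized MZVs (Ihara–Kaneko–Zagier): let $\mathfrak H=\mathbb Q\langle x,y\rangle$, $\mathfrak H^1=\mathbb Q+\mathfrak H y$, $\mathfrak H^0=\mathbb Q+x\mathfrak H y$, $z_l=x^{l-1}y$. The harmonic product $*$ on $\mathfrak H^1$ is the $\mathbb Q$-bilinear product with $1*w=w*1=w$ and $z_kw_1*z_lw_2=z_k(w_1*z_lw_2)+z_l(z_kw_1*w_2)+z_{k+l}(w_1*w_2)$; $\mathrm{sh}$ is the usual shuffle product. Let $Z:\mathfrak H^0\to\mathbb R$ be the $\mathbb Q$-linear map $z_{l_1}\cdots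 z_{l_n}\mapsto\zeta_n(l_1,\dots,l_n)$. For $\bullet\in\{*,\mathrm{sh}\}$, $Z^\bullet:(\mathfrak H^1,\bullet)\to\mathbb R[T]$ is the unique algebra homomorphism extending $Z$ and sending $y\mapsto T$; for $\mathbf l\in\mathbb N^n$ put $Z^\bullet(\mathbf l;T)=Z^\bullet(z_{l_1}\cdots z_{l_n})$ and $\zeta^\bullet_n(\mathbf l)=Z^\bullet(\mathbf l;0)$ (harmonic and shuffle regularized MZVs). Characteristic functions: $\chi^*_n(\mathbf l)=1$ for all $\mathbf l\in\mathbb N^n$, and $\chi^{\mathrm{sh}}_n(\mathbf l)=0$ if $l_1=\dots=l_n=1$, $=1$ otherwise. *)

theory Defs
  imports "HOL-Analysis.Analysis" "HOL-Library.Poly_Mapping"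
    "HOL-Library.FuncSet" "HOL-Computational_Algebra.Polynomial"
begin

definition mzv :: "nat list \<Rightarrow> real" where
  "mzv l = (\<Sum>\<^sub>\<infinity>m\<in>{m :: nat list. length m = length l \<and> sorted_wrt (>) m \<and> (\<forall>i\<in>set m. i > 0)}.
              \<Prod>i<length l. 1 / real (m ! i) ^ (l ! i))"

datatype letter = Lx | Ly

text \<open>The algebra of noncommutative polynomials in \<open>x, y\<close> over the rationals: finitely supported
  rational-valued functions on words. Words carry no monoid class instance here, so concatenation
  is introduced below as the bilinear extension of append.\<close>

type_synonym ncpoly = "letter list \<Rightarrow>\<^sub>0 rat"

definition word :: "letter list \<Rightarrow> ncpoly" where
  "word w = Poly_Mapping.single w 1"

definition scale :: "rat \<Rightarrow> ncpoly \<Rightarrow> ncpoly" where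
  "scale c p = Poly_Mapping.map ((*) c) p"

definition bilin :: "(letter list \<Rightarrow> letter list \<Rightarrow> ncpoly) \<Rightarrow> ncpoly \<Rightarrow> ncpoly \<Rightarrow> ncpoly" where
  "bilin f p q = (\<Sum>u\<in>Poly_Mapping.keys p. \<Sum>v\<in>Poly_Mapping.keys q. scale (Poly_Mapping.lookup p u * Poly_Mapping.lookup q v) (f u v))"

definition conc :: "ncpoly \<Rightarrow> ncpoly \<Rightarrow> ncpoly" (infixl "\<cdot>" 70) where
  "p \<cdot> q = bilin (\<lambda>u v. word (u @ v)) p q"

definition H1 :: "ncpoly set" where
  "H1 = {scale c (word []) + p \<cdot> word [Ly] | c p. True}"

definition H0 :: "ncpoly set" where
  "H0 = {scale c (word []) + word [Lx] \<cdot> p \<cdot> word [Ly] | c p. True}"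

definition zletters :: "nat \<Rightarrow> letter list" where
  "zletters k = replicate (k - 1) Lx @ [Ly]"

text \<open>The word \<open>z\<^sub>l\<^sub>1 \<dots> z\<^sub>l\<^sub>n\<close>.\<close>

definition zword :: "nat list \<Rightarrow> letter list" where
  "zword l = concat (map zletters l)"

text \<open>Inverse of \<^const>\<open>zword\<close> on words that are empty or end in \<open>y\<close> (see the two lemmas below);
  the first argument is one more than the number of letters \<open>x\<close> read since the last \<open>y\<close>.
  The values on words ending in \<open>x\<close> are irrelevant.\<close>

fun indices_from :: "nat \<Rightarrow> letter list \<Rightarrow> nat list" where
  "indices_from k [] = []"
| "indices_from k (Lx # w) = indices_from (Suc k) w"
| "indices_from k (Ly # w) = k # indices_from 1 w"

definition indices :: "letter list \<Rightarrow> nat list" where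
  "indices w = indices_from 1 w"

lemma indices_from_zletters:
  "indices_from k (replicate j Lx @ Ly # w) = (k + j) # indices_from 1 w"
  by (induction j arbitrary: k) auto

lemma indices_zword: "(\<forall>k\<in>set l. k \<ge> 1) \<Longrightarrow> indices (zword l) = l"
  by (induction l) (auto simp: indices_def zword_def zletters_def indices_from_zletters)

lemma zword_indices_from:
  "k \<ge> 1 \<Longrightarrow> zword (indices_from k (w @ [Ly])) = replicate (k - 1) Lx @ w @ [Ly]"
proof (induction w arbitrary: k)
  case Nil
  then show ?case by (simp add: zword_def zletters_def)
next
  case (Cons a w)
  have "replicate k Lx = replicate (k - 1) Lx @ [Lx]"
    using Cons.prems by (metis Suc_diff_1 Suc_le_lessD One_nat_def replicate_Suc replicate_append_same)
  then show ?case
    using Cons.IH[of "Suc k"] Cons.IH[of 1]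
    by (cases a) (auto simp: zword_def zletters_def)
qed

lemma zword_indices: "zword (indices (w @ [Ly])) = w @ [Ly]"
  using zword_indices_from[of 1 w] by (simp add: indices_def)

fun harm_idx :: "nat list \<Rightarrow> nat list \<Rightarrow> ncpoly" where
  "harm_idx [] v = word (zword v)"
| "harm_idx (k # u) [] = word (zword (k # u))"
| "harm_idx (k # u) (l # v) =
     word (zletters k) \<cdot> harm_idx u (l # v)
   + word (zletters l) \<cdot> harm_idx (k # u) v
   + word (zletters (k + l)) \<cdot> harm_idx u v"

fun sh_word :: "letter list \<Rightarrow> letter list \<Rightarrow> ncpoly" where
  "sh_word [] v = word v"
| "sh_word (a # u) [] = word (a # u)"
| "sh_word (a # u) (b # v) =
     word [a] \<cdot> sh_word u (b # v) + word [b] \<cdot> sh_word (a # u) v"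

datatype prod_kind = Harmonic | Shuffle

text \<open>For \<^const>\<open>Harmonic\<close> this is the harmonic product only on \<^const>\<open>H1\<close>, where alone it is used.\<close>

fun nc_prod :: "prod_kind \<Rightarrow> ncpoly \<Rightarrow> ncpoly \<Rightarrow> ncpoly" where
  "nc_prod Harmonic = bilin (\<lambda>u v. harm_idx (indices u) (indices v))"
| "nc_prod Shuffle = bilin sh_word"

text \<open>The linear map \<open>Z\<close>; meaningful on \<^const>\<open>H0\<close>.\<close>

definition Zmap :: "ncpoly \<Rightarrow> real" where
  "Zmap p = (\<Sum>w\<in>Poly_Mapping.keys p. of_rat (Poly_Mapping.lookup p w) * mzv (indices w))"

text \<open>Unitality of the homomorphism is the case \<open>p = word []\<close> of the extension property.
  Maps defined on \<^const>\<open>H1\<close> are represented by functions that are \<^const>\<open>undefined\<close> elsewhere, so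
  that uniqueness on \<^const>\<open>H1\<close> is uniqueness as a HOL function.\<close>

definition is_regularization :: "prod_kind \<Rightarrow> (ncpoly \<Rightarrow> real poly) \<Rightarrow> bool" where
  "is_regularization b f \<longleftrightarrow>
     f \<in> extensional H1 \<and>
     (\<forall>p\<in>H1. \<forall>q\<in>H1. f (p + q) = f p + f q) \<and>
     (\<forall>c. \<forall>p\<in>H1. f (scale c p) = smult (of_rat c) (f p)) \<and>
     (\<forall>p\<in>H1. \<forall>q\<in>H1. f (nc_prod b p q) = f p * f q) \<and>
     (\<forall>p\<in>H0. f p = [:Zmap p:]) \<and>
     f (word [Ly]) = [:0, 1:]"

definition Zreg :: "prod_kind \<Rightarrow> ncpoly \<Rightarrow> real poly" where
  "Zreg b = (THE f. is_regularization b f)"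

definition rmzv :: "prod_kind \<Rightarrow> nat list \<Rightarrow> real" where
  "rmzv b l = poly (Zreg b (word (zword l))) 0"

fun chi :: "prod_kind \<Rightarrow> nat list \<Rightarrow> real" where
  "chi Harmonic l = 1"
| "chi Shuffle l = (if \<forall>k\<in>set l. k = 1 then 0 else 1)"

end

theory Submission
  imports Defs
begin

text \<open>
  Both regularizations are read off from asymptotic expansions. Let \<open>c\<^sub>w(n)\<close> be the coefficient of
  \<open>t\<^sup>n\<close> in the multiple polylogarithm of the word \<open>w\<close>. The truncated sums \<open>\<Sum>n\<le>M. c\<^sub>w(n)\<close> are
  multiplicative for the harmonic product and the series \<open>Li\<^sub>w(t)\<close> for the shuffle product. Each
  of them is a polynomial in its value \<open>T\<close> at the word \<open>y\<close> (the harmonic number, resp.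
  \<open>- ln (1 - t)\<close>), up to an error that tends to \<open>0\<close> faster than every power of \<open>1/T\<close>; this polynomial
  is \<open>Z\<^sup>\<bullet>(w; T)\<close>.

  For the harmonic product the three identities are formal consequences of multiplicativity. For the shuffle
  product one compares the two valuations: if \<open>w\<^sub>0\<close> is admissible, then the coefficients of
  \<open>Li(w\<^sub>0 * w\<^sub>1) - \<zeta>(w\<^sub>0) Li(w\<^sub>1)\<close> have partial sums tending to \<open>0\<close>, so Abel's limit theorem gives
  \<open>Z\<^sup>s\<^sup>h(w\<^sub>0 * w\<^sub>1) = \<zeta>(w\<^sub>0) Z\<^sup>s\<^sup>h(w\<^sub>1)\<close>. As long as some index is at least \<open>2\<close>, these relations together
  with \<open>\<zeta>\<^sup>s\<^sup>h(1, \<dots>, 1) = 0\<close> suffice, by linear algebra in each pattern of indices equal to \<open>1\<close>.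
\<close>

section \<open>Noncommutative polynomials\<close>

lemma lookup_scale: "Poly_Mapping.lookup (scale c p) w = c * Poly_Mapping.lookup p w"
  by (simp add: scale_def Poly_Mapping.map.rep_eq when_def)

lemma keys_scale: "Poly_Mapping.keys (scale c p) \<subseteq> Poly_Mapping.keys p"
  by (auto simp: in_keys_iff lookup_scale)

lemma keys_word [simp]: "Poly_Mapping.keys (word w) = {w}"
  by (simp add: word_def)

lemma lookup_word: "Poly_Mapping.lookup (word w) v = (if v = w then 1 else 0)"
  by (simp add: word_def lookup_single when_def)

lemma scale_one [simp]: "scale 1 p = p"
  by (rule poly_mapping_eqI) (simp add: lookup_scale)

lemma scale_scale: "scale c (scale d p) = scale (c * d) p"
  by (rule poly_mapping_eqI) (simp add: lookup_scale)

lemma scale_add: "scale c (p + q) = scale c p + scale c q"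
  by (rule poly_mapping_eqI) (simp add: lookup_scale lookup_add algebra_simps)

lemma sum_scale_word:
  "(\<Sum>w\<in>Poly_Mapping.keys p. scale (Poly_Mapping.lookup p w) (word w)) = p"
  by (rule poly_mapping_eqI)
     (auto simp: lookup_sum lookup_scale lookup_word if_distrib cong: if_cong simp: in_keys_iff)

lemma bilin_word [simp]: "bilin f (word u) (word v) = f u v"
  by (simp add: bilin_def lookup_word)

lemma keys_bilin:
  assumes "\<And>u v. u \<in> Poly_Mapping.keys p \<Longrightarrow> v \<in> Poly_Mapping.keys q \<Longrightarrow> Poly_Mapping.keys (f u v) \<subseteq> K"
  shows "Poly_Mapping.keys (bilin f p q) \<subseteq> K"
  unfolding bilin_def
  by (intro order.trans[OF keys_sum] UN_least order.trans[OF keys_scale] assms)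

lemma keys_conc:
  "Poly_Mapping.keys (p \<cdot> q) \<subseteq> (\<lambda>(u, v). u @ v) ` (Poly_Mapping.keys p \<times> Poly_Mapping.keys q)"
  unfolding conc_def by (rule keys_bilin) auto

lemma keys_word_conc: "Poly_Mapping.keys (word u \<cdot> p) \<subseteq> (@) u ` Poly_Mapping.keys p"
  using keys_conc[of "word u" p] by auto

section \<open>Linear extension of maps on words\<close>

locale rat_hom =
  fixes h :: "rat \<Rightarrow> 'b::comm_ring_1"
  assumes h_add: "h (a + c) = h a + h c"
    and h_mult: "h (a * c) = h a * h c"
    and h_one [simp]: "h 1 = 1"
begin

text \<open>The scalars act through a ring homomorphism \<open>h\<close>, so that one development
  serves values in the reals, in real polynomials and in real power series (\<open>rlin\<close>,
  \<open>plin\<close>, \<open>flin\<close> below).\<close>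

definition lin :: "(letter list \<Rightarrow> 'b) \<Rightarrow> ncpoly \<Rightarrow> 'b" where
  "lin g p = (\<Sum>w\<in>Poly_Mapping.keys p. h (Poly_Mapping.lookup p w) * g w)"

lemma h_zero [simp]: "h 0 = 0"
  using h_add[of 0 0] by simp

lemma lin_superset:
  assumes "finite K" "Poly_Mapping.keys p \<subseteq> K"
  shows "lin g p = (\<Sum>w\<in>K. h (Poly_Mapping.lookup p w) * g w)"
  unfolding lin_def using assms by (intro sum.mono_neutral_left) (auto simp: in_keys_iff)

lemma lin_add: "lin g (p + q) = lin g p + lin g q"
proof -
  let ?K = "Poly_Mapping.keys p \<union> Poly_Mapping.keys q"
  have "lin g (p + q) = (\<Sum>w\<in>?K. h (Poly_Mapping.lookup (p + q) w) * g w)"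
    by (rule lin_superset) (use keys_add[of p q] in auto)
  also have "\<dots> = lin g p + lin g q"
    by (simp add: lin_superset[of ?K p] lin_superset[of ?K q] lookup_add h_add algebra_simps
          sum.distrib)
  finally show ?thesis .
qed

lemma lin_zero [simp]: "lin g 0 = 0"
  by (simp add: lin_def)

lemma lin_scale: "lin g (scale c p) = h c * lin g p"
  using lin_superset[of "Poly_Mapping.keys p" "scale c p" g] keys_scale[of c p]
  by (simp add: lin_def lookup_scale h_mult sum_distrib_left mult.assoc)

lemma lin_word [simp]: "lin g (word w) = g w"
  by (simp add: lin_def lookup_word)

lemma lin_sum: "lin g (sum f I) = (\<Sum>i\<in>I. lin g (f i))"
  by (induction I rule: infinite_finite_induct) (auto simp: lin_add)

lemma lin_cong: "(\<And>w. w \<in> Poly_Mapping.keys p \<Longrightarrow> g w = g' w) \<Longrightarrow> lin g p = lin g' p"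
  by (simp add: lin_def)

lemma lin_cmult: "lin (\<lambda>w. c * g w) p = c * lin g p"
  by (simp add: lin_def sum_distrib_left mult.left_commute)

lemma lin_bilin:
  "lin g (bilin f p q) = (\<Sum>u\<in>Poly_Mapping.keys p. \<Sum>v\<in>Poly_Mapping.keys q.
     h (Poly_Mapping.lookup p u) * h (Poly_Mapping.lookup q v) * lin g (f u v))"
  by (simp add: bilin_def lin_sum lin_scale h_mult)

lemma lin_word_conc: "lin g (word u \<cdot> p) = lin (\<lambda>w. g (u @ w)) p"
  by (simp add: conc_def lin_bilin lookup_word) (simp add: lin_def)

lemma lin_bilin_mult:
  assumes "\<And>u v. u \<in> Poly_Mapping.keys p \<Longrightarrow> v \<in> Poly_Mapping.keys q \<Longrightarrow> lin g (f u v) = g u * g v"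
  shows "lin g (bilin f p q) = lin g p * lin g q"
proof -
  have "lin g (bilin f p q) = (\<Sum>u\<in>Poly_Mapping.keys p. \<Sum>v\<in>Poly_Mapping.keys q.
     (h (Poly_Mapping.lookup p u) * g u) * (h (Poly_Mapping.lookup q v) * g v))"
    unfolding lin_bilin by (intro sum.cong refl) (simp add: assms mult_ac)
  then show ?thesis
    by (simp add: lin_def sum_product)
qed

end

global_interpretation rl: rat_hom "of_rat :: rat \<Rightarrow> real"
  defines rlin = rl.lin
  by unfold_locales (simp_all add: of_rat_add of_rat_mult)

global_interpretation pl: rat_hom "\<lambda>c. [:of_rat c:] :: real poly"
  defines plin = pl.lin
  by unfold_locales (simp_all add: of_rat_add of_rat_mult one_pCons)

global_interpretation fl: rat_hom "\<lambda>c. fps_const (of_rat c) :: real fps"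
  defines flin = fl.lin
  by unfold_locales (simp_all add: of_rat_add of_rat_mult fps_const_add[symmetric] fps_const_mult[symmetric]
     del: fps_const_add fps_const_mult)

lemma poly_plin: "poly (plin P p) t = rlin (\<lambda>w. poly (P w) t) p"
  by (simp add: pl.lin_def rl.lin_def poly_sum)

lemma fps_nth_flin: "fps_nth (flin A p) n = rlin (\<lambda>w. fps_nth (A w) n) p"
  by (simp add: fl.lin_def rl.lin_def fps_sum_nth)

lemma fps_deriv_flin: "fps_deriv (flin A p) = flin (\<lambda>w. fps_deriv (A w)) p"
  by (simp add: fl.lin_def fps_deriv_sum)

section \<open>The words that span \<open>H1\<close> and \<open>H0\<close>\<close>

definition word_ends :: "letter list \<Rightarrow> bool" where
  "word_ends w \<longleftrightarrow> w \<noteq> [] \<and> last w = Ly"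

definition W1 :: "letter list set" where
  "W1 = {w. w = [] \<or> word_ends w}"

definition W0 :: "letter list set" where
  "W0 = {w. w = [] \<or> word_ends w \<and> hd w = Lx}"

lemma W0_subset_W1: "W0 \<subseteq> W1"
  by (auto simp: W0_def W1_def)

lemma Nil_in_W1 [simp]: "[] \<in> W1"
  by (simp add: W1_def)

lemma word_ends_Cons: "word_ends (a # w) \<longleftrightarrow> word_ends w \<or> a = Ly \<and> w = []"
  by (auto simp: word_ends_def)

lemma word_ends_imp_W1: "word_ends w \<Longrightarrow> w \<in> W1"
  by (simp add: W1_def)

lemma Ly_Cons_W1: "w \<in> W1 \<Longrightarrow> word_ends (Ly # w)"
  by (auto simp: W1_def word_ends_Cons)

lemma word_ends_iff: "word_ends w \<longleftrightarrow> (\<exists>v. w = v @ [Ly])"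
  by (metis append_butlast_last_id last_snoc snoc_eq_iff_butlast word_ends_def)

text \<open>An induction principle: membership in a linear subspace is tested on words. It
  identifies \<open>H1\<close> and \<open>H0\<close> by their supports and carries the uniqueness of
  the regularization from words to polynomials.\<close>

lemma keys_subset_span:
  assumes word: "\<And>w. w \<in> K \<Longrightarrow> word w \<in> S" and zero: "0 \<in> S"
    and add: "\<And>p q. p \<in> S \<Longrightarrow> q \<in> S \<Longrightarrow> p + q \<in> S"
    and scale: "\<And>c p. p \<in> S \<Longrightarrow> scale c p \<in> S"
    and p: "Poly_Mapping.keys p \<subseteq> K"
  shows "p \<in> S"
proof -
  have "(\<Sum>w\<in>I. scale (Poly_Mapping.lookup p w) (word w)) \<in> S" if "I \<subseteq> K" for I
    using that by (induction I rule: infinite_finite_induct) (auto intro!: zero add scale word)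
  from this[OF p] show ?thesis
    by (simp add: sum_scale_word)
qed

lemma lookup_bilin:
  assumes "finite K" "finite L" "Poly_Mapping.keys p \<subseteq> K" "Poly_Mapping.keys q \<subseteq> L"
  shows "Poly_Mapping.lookup (bilin f p q) w =
    (\<Sum>u\<in>K. \<Sum>v\<in>L. Poly_Mapping.lookup p u * Poly_Mapping.lookup q v * Poly_Mapping.lookup (f u v) w)"
proof -
  have "Poly_Mapping.lookup (bilin f p q) w = (\<Sum>u\<in>Poly_Mapping.keys p. \<Sum>v\<in>L.
      Poly_Mapping.lookup p u * Poly_Mapping.lookup q v * Poly_Mapping.lookup (f u v) w)"
    unfolding bilin_def lookup_sum lookup_scale
    by (intro sum.cong refl sum.mono_neutral_left) (use assms in \<open>auto simp: in_keys_iff\<close>)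
  also have "\<dots> = (\<Sum>u\<in>K. \<Sum>v\<in>L.
      Poly_Mapping.lookup p u * Poly_Mapping.lookup q v * Poly_Mapping.lookup (f u v) w)"
    by (rule sum.mono_neutral_left) (use assms in \<open>auto simp: in_keys_iff\<close>)
  finally show ?thesis .
qed

lemma bilin_add_left: "bilin f (p + q) r = bilin f p r + bilin f q r"
  using keys_add[of p q]
  by (intro poly_mapping_eqI)
     (simp add: lookup_bilin[where K = "Poly_Mapping.keys p \<union> Poly_Mapping.keys q" and L = "Poly_Mapping.keys r"]
        lookup_add sum.distrib algebra_simps)

lemma bilin_add_right: "bilin f r (p + q) = bilin f r p + bilin f r q"
  using keys_add[of p q]
  by (intro poly_mapping_eqI)
     (simp add: lookup_bilin[where L = "Poly_Mapping.keys p \<union> Poly_Mapping.keys q" and K = "Poly_Mapping.keys r"]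
        lookup_add sum.distrib algebra_simps)

lemma bilin_scale_left: "bilin f (scale c p) r = scale c (bilin f p r)"
  using keys_scale[of c p]
  by (intro poly_mapping_eqI)
     (simp add: lookup_bilin[where K = "Poly_Mapping.keys p" and L = "Poly_Mapping.keys r"]
        lookup_scale sum_distrib_left mult.assoc)

lemma bilin_scale_right: "bilin f r (scale c p) = scale c (bilin f r p)"
  using keys_scale[of c p]
  by (intro poly_mapping_eqI)
     (simp add: lookup_bilin[where L = "Poly_Mapping.keys p" and K = "Poly_Mapping.keys r"]
        lookup_scale sum_distrib_left mult_ac)

lemma conc_word [simp]: "word u \<cdot> word v = word (u @ v)"
  by (simp add: conc_def)

text \<open>Common argument for \<open>H1\<close> and \<open>H0\<close>: \<open>g\<close> maps p to
  p y or to x p y, \<open>K'\<close> consists of the words reached by it, and the scalar summand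
  accounts for the empty word.\<close>

lemma keys_H_subset:
  assumes lin: "S = {scale c (word []) + g p | c p. True}"
    and add: "\<And>p q. g (p + q) = g p + g q" and sc: "\<And>c p. g (scale c p) = scale c (g p)"
    and Nil: "K = insert [] K'"
    and keys: "\<And>p. Poly_Mapping.keys (g p) \<subseteq> K"
    and word: "\<And>w. w \<in> K' \<Longrightarrow> \<exists>p. g p = word w"
  shows "S = {p. Poly_Mapping.keys p \<subseteq> K}"
proof (rule equalityI; rule subsetI)
  fix p assume "p \<in> S"
  then obtain c q where p: "p = scale c (word []) + g q"
    using lin by auto
  have "Poly_Mapping.keys p \<subseteq> K"
    using keys_add[of "scale c (word [])" "g q"] keys[of q] keys_scale[of c "word []"]
    unfolding p Nil by auto
  then show "p \<in> {p. Poly_Mapping.keys p \<subseteq> K}" by simp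
next
  fix p :: ncpoly assume "p \<in> {p. Poly_Mapping.keys p \<subseteq> K}"
  then have p: "Poly_Mapping.keys p \<subseteq> K" by simp
  have scale0: "scale 0 q = 0" for q
    by (rule poly_mapping_eqI) (simp add: lookup_scale)
  have g0: "g 0 = 0"
    using sc[of 0 0] by (simp add: scale0)
  have scale_add_left: "scale (c + d) q = scale c q + scale d q" for c d q
    by (rule poly_mapping_eqI) (simp add: lookup_scale lookup_add algebra_simps)
  show "p \<in> S"
  proof (rule keys_subset_span[OF _ _ _ _ p])
    fix w assume "w \<in> K"
    then consider "w = []" | "w \<in> K'" using Nil by auto
    then show "word w \<in> S"
    proof cases
      case 1
      have "word w = scale 1 (word []) + g 0" by (simp add: 1 g0)
      then show ?thesis unfolding lin by blast
    next
      case 2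
      then obtain q where "g q = word w" using word by blast
      then have "word w = scale 0 (word []) + g q" by (simp add: scale0)
      then show ?thesis unfolding lin by blast
    qed
  next
    have "0 = scale 0 (word []) + g 0" by (simp add: g0 scale0)
    then show "0 \<in> S" unfolding lin by blast
  next
    fix q r assume "q \<in> S" "r \<in> S"
    then obtain c d q' r' where "q = scale c (word []) + g q'" "r = scale d (word []) + g r'"
      unfolding lin by auto
    then have "q + r = scale (c + d) (word []) + g (q' + r')"
      by (simp add: add scale_add_left)
    then show "q + r \<in> S" unfolding lin by blast
  next
    fix c q assume "q \<in> S"
    then obtain d q' where "q = scale d (word []) + g q'"
      unfolding lin by auto
    then have "scale c q = scale (c * d) (word []) + g (scale c q')"
      by (simp add: sc scale_add scale_scale)
    then show "scale c q \<in> S" unfolding lin by blast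
  qed
qed

lemma W1_eq: "W1 = insert [] {w. word_ends w}"
  by (auto simp: W1_def)

lemma W0_eq: "W0 = insert [] {w. word_ends w \<and> hd w = Lx}"
  by (auto simp: W0_def)

lemma H1_eq: "H1 = {p. Poly_Mapping.keys p \<subseteq> W1}"
proof (rule keys_H_subset[OF H1_def _ _ W1_eq])
  show "Poly_Mapping.keys (p \<cdot> word [Ly]) \<subseteq> W1" for p
    using keys_conc[of p "word [Ly]"] by (auto simp: W1_def word_ends_def)
  show "\<exists>p. p \<cdot> word [Ly] = word w" if w: "w \<in> {w. word_ends w}" for w
  proof -
    obtain v where "w = v @ [Ly]" using w by (auto simp: word_ends_iff)
    then have "word v \<cdot> word [Ly] = word w" by simp
    then show ?thesis by blast
  qed
qed (simp_all add: conc_def bilin_add_left bilin_scale_left)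

lemma H0_eq: "H0 = {p. Poly_Mapping.keys p \<subseteq> W0}"
proof (rule keys_H_subset[OF H0_def _ _ W0_eq])
  show "Poly_Mapping.keys (word [Lx] \<cdot> p \<cdot> word [Ly]) \<subseteq> W0" for p
  proof
    fix w assume "w \<in> Poly_Mapping.keys (word [Lx] \<cdot> p \<cdot> word [Ly])"
    then obtain u where u: "u \<in> Poly_Mapping.keys (word [Lx] \<cdot> p)" "w = u @ [Ly]"
      using keys_conc[of "word [Lx] \<cdot> p" "word [Ly]"] by auto
    then obtain v where "u = Lx # v"
      using keys_word_conc[of "[Lx]" p] by auto
    with u show "w \<in> W0"
      by (simp add: W0_def word_ends_def)
  qed
  show "\<exists>p. word [Lx] \<cdot> p \<cdot> word [Ly] = word w" if w: "w \<in> {w. word_ends w \<and> hd w = Lx}" for w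
  proof -
    obtain v where v: "w = v @ [Ly]" using w by (auto simp: word_ends_iff)
    with w obtain v' where "v = Lx # v'" by (cases v) auto
    with v have "word [Lx] \<cdot> word v' \<cdot> word [Ly] = word w" by simp
    then show ?thesis by blast
  qed
qed (simp_all add: conc_def bilin_add_left bilin_scale_left bilin_add_right bilin_scale_right)

lemma keys_add_subset:
  "Poly_Mapping.keys p \<subseteq> K \<Longrightarrow> Poly_Mapping.keys q \<subseteq> K \<Longrightarrow> Poly_Mapping.keys (p + q) \<subseteq> K"
  using keys_add[of p q] by blast

lemma keys_word_conc_subset:
  "(\<And>w. w \<in> Poly_Mapping.keys p \<Longrightarrow> u @ w \<in> K) \<Longrightarrow> Poly_Mapping.keys (word u \<cdot> p) \<subseteq> K"
  using keys_word_conc[of u p] by blast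

section \<open>Multiple polylogarithms\<close>

text \<open>For \<open>n = 0\<close> the quotients are \<open>0\<close> by \<open>x / 0 = 0\<close>. In particular \<open>Li [Lx] = 0\<close>, so words ending in
  \<open>x\<close> get a junk value.\<close>

fun Li :: "letter list \<Rightarrow> real fps" where
  "Li [] = 1"
| "Li (Lx # w) = Abs_fps (\<lambda>n. fps_nth (Li w) n / real n)"
| "Li (Ly # w) = Abs_fps (\<lambda>n. (\<Sum>m<n. fps_nth (Li w) m) / real n)"

lemma Li_Cons_nth_0 [simp]: "fps_nth (Li (a # w)) 0 = 0"
  by (cases a) simp_all

fun dform :: "letter \<Rightarrow> real fps" where
  "dform Lx = 1 - fps_X"
| "dform Ly = fps_X"

text \<open>The form \<open>dt/t\<close> belongs to \<open>x\<close> and \<open>dt/(1 - t)\<close> to \<open>y\<close>; both are multiplied by \<open>t (1 - t)\<close> here, so that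
  no division occurs.\<close>

lemma fps_deriv_Li:
  assumes "word_ends (a # w)"
  shows "fps_X * (1 - fps_X) * fps_deriv (Li (a # w)) = dform a * Li w"
proof (cases a)
  case Lx
  then have "w \<noteq> []"
    using assms by (auto simp: word_ends_def split: if_splits)
  \<comment> \<open>Dividing the coefficients by n and then multiplying by n loses the coefficient
    at 0. For a word ending in y nothing is lost, as this coefficient vanishes.\<close>
  then have "fps_nth (Li w) 0 = 0"
    by (cases w) simp_all
  then have "fps_X * fps_deriv (Li (Lx # w)) = Li w"
    by (intro fps_ext) (simp add: fps_X_mult_nth)
  then show ?thesis
    using Lx by (simp add: algebra_simps)
next
  case Ly
  have "(1 - fps_X) * fps_deriv (Li (Ly # w)) = Li w"
  proof (rule fps_ext)
    fix n show "fps_nth ((1 - fps_X) * fps_deriv (Li (Ly # w))) n = fps_nth (Li w) n"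
      by (cases n) (simp_all add: left_diff_distrib fps_X_mult_nth)
  qed
  then show ?thesis
    using Ly by (simp add: mult.assoc)
qed

text \<open>A word occurring in a shuffle ends with the last letter of one of the two
  factors.\<close>

lemma keys_sh_word:
  "u \<in> W1 \<Longrightarrow> v \<in> W1 \<Longrightarrow> u \<noteq> [] \<or> v \<noteq> [] \<Longrightarrow> Poly_Mapping.keys (sh_word u v) \<subseteq> {w. word_ends w}"
proof (induction u v rule: sh_word.induct)
  case (3 a u b v)
  have uv: "word_ends (a # u)" "word_ends (b # v)" "u \<in> W1" "v \<in> W1"
    using "3.prems" by (auto simp: W1_def word_ends_Cons)
  have 1: "Poly_Mapping.keys (sh_word u (b # v)) \<subseteq> {w. word_ends w}"
    "Poly_Mapping.keys (sh_word (a # u) v) \<subseteq> {w. word_ends w}"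
    using 3 uv by auto
  then show ?case
    unfolding sh_word.simps
    by (intro keys_add_subset keys_word_conc_subset) (auto simp: word_ends_Cons)
qed (auto simp: W1_def)

lemma keys_sh_word_W1: "u \<in> W1 \<Longrightarrow> v \<in> W1 \<Longrightarrow> Poly_Mapping.keys (sh_word u v) \<subseteq> W1"
  using keys_sh_word[of u v] by (cases "u = [] \<and> v = []") (auto simp: W1_def)

lemma fps_deriv_flin_Li:
  assumes "Poly_Mapping.keys p \<subseteq> {w. word_ends w}"
  shows "fps_X * (1 - fps_X) * fps_deriv (flin Li (word [a] \<cdot> p)) = dform a * flin Li p"
proof -
  have "fps_X * (1 - fps_X) * fps_deriv (flin Li (word [a] \<cdot> p)) =
      flin (\<lambda>w. fps_X * (1 - fps_X) * fps_deriv (Li (a # w))) p"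
    by (simp add: fl.lin_word_conc fps_deriv_flin fl.lin_cmult)
  also have "\<dots> = flin (\<lambda>w. dform a * Li w) p"
    by (rule fl.lin_cong) (use assms in \<open>auto intro!: fps_deriv_Li simp: word_ends_Cons\<close>)
  finally show ?thesis
    by (simp add: fl.lin_cmult)
qed

text \<open>The recursion of the shuffle product is the Leibniz rule for t (1 - t) d/dt. By
  induction both sides have the same image under this operator; the factor t (1 - t) cancels, and
  both constant terms are 0.\<close>

lemma flin_Li_sh_word: "u \<in> W1 \<Longrightarrow> v \<in> W1 \<Longrightarrow> flin Li (sh_word u v) = Li u * Li v"
proof (induction u v rule: sh_word.induct)
  case (3 a u b v)
  have uv: "word_ends (a # u)" "word_ends (b # v)" "u \<in> W1" "v \<in> W1"
    using "3.prems" by (auto simp: W1_def word_ends_Cons)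
  have IH: "flin Li (sh_word u (b # v)) = Li u * Li (b # v)"
    "flin Li (sh_word (a # u) v) = Li (a # u) * Li v"
    using 3 uv by auto
  let ?D = "\<lambda>f :: real fps. fps_X * (1 - fps_X) * fps_deriv f"
  have keys: "Poly_Mapping.keys (sh_word u (b # v)) \<subseteq> {w. word_ends w}"
    "Poly_Mapping.keys (sh_word (a # u) v) \<subseteq> {w. word_ends w}"
    using keys_sh_word[of u "b # v"] keys_sh_word[of "a # u" v] uv "3.prems" by auto
  have "?D (flin Li (sh_word (a # u) (b # v))) =
      dform a * (Li u * Li (b # v)) + dform b * (Li (a # u) * Li v)"
    using fps_deriv_flin_Li[OF keys(1), of a] fps_deriv_flin_Li[OF keys(2), of b]
    by (simp add: fl.lin_add distrib_left IH)
  also have "\<dots> = ?D (Li (a # u)) * Li (b # v) + Li (a # u) * ?D (Li (b # v))"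
    by (simp only: fps_deriv_Li[OF uv(1)] fps_deriv_Li[OF uv(2)]) (simp add: algebra_simps)
  also have "\<dots> = ?D (Li (a # u) * Li (b # v))"
    by (simp add: algebra_simps)
  finally have "fps_X * (1 - fps_X) * fps_deriv (flin Li (sh_word (a # u) (b # v))) =
      fps_X * (1 - fps_X) * fps_deriv (Li (a # u) * Li (b # v))" .
  moreover have "(fps_X :: real fps) * (1 - fps_X) \<noteq> 0"
    using fps_X_neq_fps_const[of "1 :: real"] by simp
  ultimately have "fps_deriv (flin Li (sh_word (a # u) (b # v))) = fps_deriv (Li (a # u) * Li (b # v))"
    by (metis mult_cancel_left)
  moreover have "fps_nth (flin Li (sh_word (a # u) (b # v))) 0 = 0"
    by (simp add: fl.lin_add fl.lin_word_conc fps_nth_flin) (simp add: rl.lin_def)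
  ultimately show ?case
    by (simp only: fps_deriv_eq_iff) simp
qed simp_all

section \<open>Truncated multiple harmonic sums\<close>

definition hsum :: "letter list \<Rightarrow> nat \<Rightarrow> real" where
  "hsum w n = (\<Sum>m\<le>n. fps_nth (Li w) m)"

lemma hsum_Nil [simp]: "hsum [] n = 1"
  by (simp add: hsum_def)

lemma hsum_Cons_0 [simp]: "hsum (a # w) 0 = 0"
  by (simp add: hsum_def)

lemma hsum_Suc: "hsum w (Suc n) = hsum w n + fps_nth (Li w) (Suc n)"
  by (simp add: hsum_def)

lemma Li_replicate_Lx_Ly:
  "fps_nth (Li (replicate j Lx @ Ly # w)) n = (\<Sum>m<n. fps_nth (Li w) m) / real n ^ Suc j"
  by (induction j) (simp_all add: field_simps)

lemma hsum_zletters_0 [simp]: "hsum (zletters k @ w) 0 = 0"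
  by (cases "k - 1") (simp_all add: zletters_def)

text \<open>The largest summation index, to which \<open>k\<close> belongs, is either at most
  \<open>n\<close> or equal to \<open>Suc n\<close>. In the second case the remaining indices are
  strictly smaller, hence the truncation of \<open>w\<close> at \<open>n\<close>.\<close>

lemma hsum_zletters_Suc:
  assumes "k \<ge> 1"
  shows "hsum (zletters k @ w) (Suc n) = hsum (zletters k @ w) n + hsum w n / real (Suc n) ^ k"
  using assms Li_replicate_Lx_Ly[of "k - 1" w "Suc n"]
  by (simp add: hsum_Suc zletters_def hsum_def lessThan_Suc_atMost del: power_Suc)

lemma rlin_hsum_zletters_Suc:
  assumes "k \<ge> 1"
  shows "rlin (\<lambda>w. hsum w (Suc n)) (word (zletters k) \<cdot> p) =
    rlin (\<lambda>w. hsum w n) (word (zletters k) \<cdot> p) + rlin (\<lambda>w. hsum w n) p / real (Suc n) ^ k"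
  using rl.lin_cmult[of "1 / real (Suc n) ^ k" "\<lambda>w. hsum w n" p]
  by (simp add: rl.lin_word_conc hsum_zletters_Suc[OF assms] del: of_nat_Suc)
     (simp add: rl.lin_def distrib_left sum.distrib)

lemma zword_Nil [simp]: "zword [] = []"
  by (simp add: zword_def)

lemma zword_Cons: "zword (k # l) = zletters k @ zword l"
  by (simp add: zword_def)

text \<open>An induction on \<open>n\<close> inside the induction along \<open>harm_idx\<close>.
  Multiplying the two recursions of \<open>hsum_zletters_Suc\<close> gives, besides the product at
  \<open>n\<close>, three terms: the new largest index occurs in the first factor, in the second, or
  in both. They match the three summands of \<open>harm_idx\<close>.\<close>

lemma rlin_hsum_harm_idx:
  assumes "\<forall>k\<in>set u. k \<ge> 1" "\<forall>k\<in>set v. k \<ge> 1"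
  shows "rlin (\<lambda>w. hsum w n) (harm_idx u v) = hsum (zword u) n * hsum (zword v) n"
  using assms
proof (induction u v arbitrary: n rule: harm_idx.induct)
  case (3 k u l v)
  have kl: "k \<ge> 1" "l \<ge> 1" "k + l \<ge> 1"
    using "3.prems" by auto
  have IH: "rlin (\<lambda>w. hsum w n) (harm_idx u (l # v)) = hsum (zword u) n * hsum (zword (l # v)) n"
    "rlin (\<lambda>w. hsum w n) (harm_idx (k # u) v) = hsum (zword (k # u)) n * hsum (zword v) n"
    "rlin (\<lambda>w. hsum w n) (harm_idx u v) = hsum (zword u) n * hsum (zword v) n" for n
    using "3.IH" "3.prems" by auto
  show ?case
  proof (induction n)
    case 0
    show ?case
      by (simp add: rl.lin_add rl.lin_word_conc zword_Cons) (simp add: rl.lin_def)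
  next
    case (Suc n)
    then show ?case
      by (simp add: rl.lin_add kl[THEN rlin_hsum_zletters_Suc] kl[THEN hsum_zletters_Suc] IH zword_Cons
          power_add algebra_simps add_divide_distrib del: of_nat_Suc)
  qed
qed (simp_all add: zword_Cons)

lemma word_ends_zletters: "w \<in> W1 \<Longrightarrow> word_ends (zletters k @ w)"
  by (auto simp: W1_def zletters_def word_ends_def)

lemma zword_W1 [simp]: "zword l \<in> W1"
proof (induction l)
  case (Cons k l)
  then show ?case
    using word_ends_zletters[OF Cons, of k] by (simp add: zword_Cons W1_def)
qed simp

lemma keys_zletters_conc:
  "Poly_Mapping.keys p \<subseteq> W1 \<Longrightarrow> Poly_Mapping.keys (word (zletters k) \<cdot> p) \<subseteq> {w. word_ends w}"
  using keys_word_conc[of "zletters k" p] by (auto intro: word_ends_zletters)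

lemma keys_harm_idx: "Poly_Mapping.keys (harm_idx u v) \<subseteq> W1"
proof (induction u v rule: harm_idx.induct)
  case (3 k u l v)
  then show ?case
    unfolding harm_idx.simps
    by (intro keys_add_subset keys_word_conc_subset word_ends_imp_W1[OF word_ends_zletters]) auto
qed simp_all

lemma indices_from_pos: "k \<ge> 1 \<Longrightarrow> \<forall>i\<in>set (indices_from k w). i \<ge> 1"
  by (induction k w rule: indices_from.induct) auto

lemma indices_pos: "\<forall>i\<in>set (indices w). i \<ge> 1"
  unfolding indices_def by (rule indices_from_pos) simp

lemma zword_indices_W1: "w \<in> W1 \<Longrightarrow> zword (indices w) = w"
  using zword_indices by (auto simp: W1_def word_ends_iff indices_def)

section \<open>Generation by admissible words and y\<close>

abbreviation lead :: "letter list \<Rightarrow> nat" where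
  "lead w \<equiv> length (takeWhile ((=) Ly) w)"

lemma lead_zletters: "k \<ge> 2 \<Longrightarrow> lead (zletters k @ w) = 0"
  by (cases "k - 1") (auto simp: zletters_def)

lemma zletters_1 [simp]: "zletters (Suc 0) = [Ly]"
  by (simp add: zletters_def)

lemma conc_word_scale: "word u \<cdot> scale c p = scale c (word u \<cdot> p)"
  by (simp add: conc_def bilin_scale_right)

lemma conc_word_add: "word u \<cdot> (p + q) = word u \<cdot> p + word u \<cdot> q"
  by (simp add: conc_def bilin_add_right)

lemma word_add_scale_of_nat: "word w + scale (of_nat n) (word w) = scale (of_nat (Suc n)) (word w)"
  by (rule poly_mapping_eqI) (simp add: lookup_add lookup_scale algebra_simps)

lemma keys_Ly_conc:
  assumes "Poly_Mapping.keys p \<subseteq> {v \<in> W1. lead v \<le> n}"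
  shows "Poly_Mapping.keys (word [Ly] \<cdot> p) \<subseteq> {v \<in> W1. lead v \<le> Suc n}"
proof
  fix x assume "x \<in> Poly_Mapping.keys (word [Ly] \<cdot> p)"
  then obtain v where "x = Ly # v" "v \<in> W1" "lead v \<le> n"
    using keys_word_conc[of "[Ly]" p] assms by auto
  then show "x \<in> {v \<in> W1. lead v \<le> Suc n}"
    using Ly_Cons_W1[of v] by (simp add: word_ends_imp_W1)
qed

text \<open>Inserting y before, between or directly after the \<open>lead w\<close> leading letters
  y gives \<open>Ly # w\<close> each time. Every other insertion happens behind the first x and
  leaves the number of leading y unchanged.\<close>

lemma sh_word_Ly:
  assumes "w \<in> W1"
  shows "\<exists>r. sh_word [Ly] w = scale (of_nat (Suc (lead w))) (word (Ly # w)) + r \<and>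
    Poly_Mapping.keys r \<subseteq> {v \<in> W1. lead v \<le> lead w}"
  using assms
proof (induction w)
  case Nil
  show ?case by (rule exI[of _ 0]) simp
next
  case (Cons a w)
  then have w: "w \<in> W1" "word_ends (a # w)"
    by (auto simp: W1_def word_ends_Cons)
  show ?case
  proof (cases a)
    case Lx
    have "Poly_Mapping.keys (word [Lx] \<cdot> sh_word [Ly] w) \<subseteq> {v \<in> W1. lead v \<le> 0}"
    proof (rule keys_word_conc_subset)
      fix v assume "v \<in> Poly_Mapping.keys (sh_word [Ly] w)"
      then have "word_ends v"
        using keys_sh_word[of "[Ly]" w] w by (auto simp: W1_def word_ends_Cons)
      then show "[Lx] @ v \<in> {v \<in> W1. lead v \<le> 0}"
        by (simp add: W1_def word_ends_Cons)
    qed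
    then show ?thesis
      using Lx by (intro exI[of _ "word [Lx] \<cdot> sh_word [Ly] w"]) simp
  next
    case Ly
    obtain r where "sh_word [Ly] w = scale (of_nat (Suc (lead w))) (word (Ly # w)) + r"
      "Poly_Mapping.keys r \<subseteq> {v \<in> W1. lead v \<le> lead w}"
      using Cons.IH w by auto
    then show ?thesis
      using Ly keys_Ly_conc[of r "lead w"] word_add_scale_of_nat[of "Ly # Ly # w" "Suc (lead w)"]
      by (intro exI[of _ "word [Ly] \<cdot> r"])
         (simp add: conc_word_add conc_word_scale add.assoc[symmetric] del: of_nat_Suc)
  qed
qed

text \<open>As for the shuffle product, with additional contractions of the inserted 1 with an index
  \<open>k\<close>. Since \<open>k + 1\<close> is at least 2, a contraction never lengthens the
  leading block of y.\<close>

lemma harm_idx_1: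
  assumes "\<forall>k\<in>set l. k \<ge> 1"
  shows "\<exists>r. harm_idx [1] l = scale (of_nat (Suc (lead (zword l)))) (word (Ly # zword l)) + r \<and>
    Poly_Mapping.keys r \<subseteq> {v \<in> W1. lead v \<le> lead (zword l)}"
  using assms
proof (induction l)
  case Nil
  show ?case by (rule exI[of _ 0]) (simp add: zword_Cons)
next
  case (Cons k l)
  \<comment> \<open>For \<open>j\<close> at least 2 the block \<open>zletters j\<close> begins with
    x, so these words have no leading y.\<close>
  have zl: "Poly_Mapping.keys (word (zletters j) \<cdot> p) \<subseteq> {v \<in> W1. lead v \<le> n}"
    if "j \<ge> 2" "Poly_Mapping.keys p \<subseteq> W1" for j p n
  proof
    fix v assume v: "v \<in> Poly_Mapping.keys (word (zletters j) \<cdot> p)"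
    then have "v \<in> W1"
      using keys_zletters_conc[OF that(2)] by (auto intro: word_ends_imp_W1)
    moreover have "lead v = 0"
      using v keys_word_conc[of "zletters j" p] lead_zletters[OF that(1)] by auto
    ultimately show "v \<in> {v \<in> W1. lead v \<le> n}" by simp
  qed
  define s where "s = word (zletters (Suc k)) \<cdot> word (zword l)"
  have s: "Poly_Mapping.keys s \<subseteq> {v \<in> W1. lead v \<le> n}" for n
    unfolding s_def by (rule zl) (use Cons.prems in simp_all)
  have k: "harm_idx [1] (k # l) = word (Ly # zword (k # l)) + word (zletters k) \<cdot> harm_idx [1] l + s"
    by (simp add: s_def)
  show ?case
  proof (cases "k = 1")
    case True
    obtain r where r: "harm_idx [1] l = scale (of_nat (Suc (lead (zword l)))) (word (Ly # zword l)) + r"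
      "Poly_Mapping.keys r \<subseteq> {v \<in> W1. lead v \<le> lead (zword l)}"
      using Cons by auto
    have "Poly_Mapping.keys (word [Ly] \<cdot> r + s) \<subseteq> {v \<in> W1. lead v \<le> lead (zword (k # l))}"
      using keys_add[of "word [Ly] \<cdot> r" s] keys_Ly_conc[OF r(2)] s[of "lead (zword (k # l))"] True
      by (auto simp: zword_Cons)
    then show ?thesis
      unfolding k r(1)
      using True word_add_scale_of_nat[of "Ly # Ly # zword l" "Suc (lead (zword l))"]
      by (intro exI[of _ "word [Ly] \<cdot> r + s"])
         (simp add: zword_Cons conc_word_add conc_word_scale add.assoc[symmetric] del: of_nat_Suc)
  next
    case False
    then have k2: "k \<ge> 2" using Cons.prems by auto
    have "Poly_Mapping.keys (word (zletters k) \<cdot> harm_idx [1] l + s) \<subseteq> {v \<in> W1. lead v \<le> 0}"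
      using keys_add[of "word (zletters k) \<cdot> harm_idx [1] l" s] zl[OF k2 keys_harm_idx, of "[1]" l 0] s[of 0]
      by auto
    then show ?thesis
      unfolding k using lead_zletters[OF k2]
      by (intro exI[of _ "word (zletters k) \<cdot> harm_idx [1] l + s"]) (simp add: zword_Cons add.assoc)
  qed
qed

text \<open>The common form of both triangularity statements. It drives the uniqueness of the
  regularization as well as the existence of the asymptotic expansions.\<close>

lemma nc_prod_Ly:
  assumes "w \<in> W1"
  shows "\<exists>r. nc_prod b (word [Ly]) (word w) = scale (of_nat (Suc (lead w))) (word (Ly # w)) + r \<and>
    Poly_Mapping.keys r \<subseteq> {v \<in> W1. lead v \<le> lead w}"
proof (cases b)
  have indices_Ly: "indices [Ly] = [1]"
    by (simp add: indices_def)
  case Harmonic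
  then show ?thesis
    using harm_idx_1[OF indices_pos[of w]] assms indices_Ly by (simp add: zword_indices_W1)
next
  case Shuffle
  then show ?thesis
    using sh_word_Ly[OF assms] by simp
qed

lemma keys_nc_prod:
  assumes "Poly_Mapping.keys p \<subseteq> W1" "Poly_Mapping.keys q \<subseteq> W1"
  shows "Poly_Mapping.keys (nc_prod b p q) \<subseteq> W1"
proof (cases b)
  case Harmonic
  then show ?thesis
    by (auto intro!: keys_bilin keys_harm_idx)
next
  case Shuffle
  then show ?thesis
    using assms by simp (intro keys_bilin keys_sh_word_W1; blast)
qed

section \<open>Convergence\<close>

lemma Li_nonneg [simp]: "fps_nth (Li w) n \<ge> 0"
  by (induction w arbitrary: n rule: Li.induct) (auto intro!: sum_nonneg divide_nonneg_nonneg)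

lemma hsum_nonneg [simp]: "hsum w n \<ge> 0"
  by (simp add: hsum_def sum_nonneg)

lemma hsum_mono: "m \<le> n \<Longrightarrow> hsum w m \<le> hsum w n"
  unfolding hsum_def by (rule sum_mono2) auto

lemma Li_Cons_le: "fps_nth (Li (a # w)) n \<le> hsum w n / real n"
proof (cases a)
  case Lx
  have "fps_nth (Li w) n \<le> hsum w n"
    unfolding hsum_def by (rule member_le_sum) auto
  then show ?thesis
    using Lx by (simp add: divide_right_mono)
next
  case Ly
  have "(\<Sum>m<n. fps_nth (Li w) m) \<le> hsum w n"
    unfolding hsum_def by (rule sum_mono2) auto
  then show ?thesis
    using Ly by (simp add: divide_right_mono)
qed

lemma Li_le_1: "fps_nth (Li w) n \<le> 1"
proof (induction w arbitrary: n)
  case (Cons a w)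
  show ?case
  proof (cases "n = 0")
    case False
    show ?thesis
    proof (cases a)
      case Lx
      have "fps_nth (Li w) n \<le> real n"
        using Cons[of n] False by linarith
      then show ?thesis using Lx False by (simp add: divide_le_eq)
    next
      case Ly
      have "(\<Sum>m<n. fps_nth (Li w) m) \<le> real n"
        using sum_bounded_above[of "{..<n}" "fps_nth (Li w)" 1] Cons by simp
      then show ?thesis using Ly False by (simp add: divide_le_eq)
    qed
  qed simp
qed simp

text \<open>Each letter divides by the index and adds at most one summation, which costs a factor
  \<open>harm n\<close>. So the truncated sums grow at most like a power of the logarithm.\<close>

lemma hsum_le_harm: "hsum w n \<le> (1 + harm n) ^ length w"
proof (induction w)
  case (Cons a w)
  have h: "(harm n :: real) \<ge> 0" by (rule harm_nonneg)
  have "hsum (a # w) n = (\<Sum>m=1..n. fps_nth (Li (a # w)) m)"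
    unfolding hsum_def by (rule sum.mono_neutral_right) (auto simp: not_le)
  also have "\<dots> \<le> (\<Sum>m=1..n. hsum w n * inverse (of_nat m))"
  proof (rule sum_mono)
    fix m assume "m \<in> {1..n}"
    then have "hsum w m / real m \<le> hsum w n / real m"
      by (intro divide_right_mono hsum_mono) auto
    then show "fps_nth (Li (a # w)) m \<le> hsum w n * inverse (of_nat m)"
      using Li_Cons_le[of a w m] by (simp add: divide_inverse)
  qed
  also have "\<dots> = hsum w n * harm n"
    by (simp add: harm_def sum_distrib_left)
  also have "\<dots> \<le> (1 + harm n) ^ length w * (1 + harm n)"
    using Cons h by (intro mult_mono) auto
  finally show ?case by (simp add: mult.commute)
qed simp

lemma harm_le_ln: "n \<ge> 1 \<Longrightarrow> (harm n :: real) \<le> 1 + ln (real n)"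
  using decseqD[OF decseq_harm_diff_ln, of 0 "n - 1"] by (simp add: harm_expand)

text \<open>A single term of the exponential series at y/4. The 4 makes powers of logarithms cost
  only n^(1/4), so that n^(1/4 + 1/2 - 2) is still summable, and only (1 - t)^(-1/4) near t = 1,
  which is beaten by the square root of 1 - t.\<close>

lemma power_le_exp:
  assumes "(y::real) \<ge> 0"
  shows "y ^ N \<le> fact N * 4 ^ N * exp (y / 4)"
proof -
  have "(y / 4) ^ N /\<^sub>R fact N \<le> (suminf (\<lambda>n. (y / 4) ^ n /\<^sub>R fact n))"
    using sum_le_suminf[OF summable_exp_generic, of "{N}" "y / 4"] assms by simp
  then have "(y / 4) ^ N / fact N \<le> exp (y / 4)"
    unfolding exp_def by (simp only: real_scaleR_def divide_inverse_commute)
  then show ?thesis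
    by (simp add: field_simps power_divide)
qed

lemma harm_power_le:
  assumes "n \<ge> 1"
  shows "(1 + harm n) ^ N \<le> fact N * 4 ^ N * exp (1/2) * real n powr (1/4)"
proof -
  have "(1 + harm n) ^ N \<le> (2 + ln (real n)) ^ N"
    using harm_le_ln[OF assms] harm_nonneg[of n, where 'a = real] by (intro power_mono) auto
  also have "\<dots> \<le> fact N * 4 ^ N * exp ((2 + ln (real n)) / 4)"
    using assms by (intro power_le_exp) auto
  also have "exp ((2 + ln (real n)) / 4) = exp (1/2) * real n powr (1/4)"
    using assms by (simp add: powr_def add_divide_distrib exp_add)
  finally show ?thesis by (simp add: mult.assoc)
qed

lemma summable_harm_power:
  "summable (\<lambda>n. (1 + harm n) ^ N * sqrt (real n) / (real n)\<^sup>2)"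
proof (rule summable_comparison_test_ev)
  let ?C = "fact N * 4 ^ N * exp (1/2) :: real"
  show "summable (\<lambda>n. ?C * real n powr (-5/4))"
    by (intro summable_mult) (simp add: summable_real_powr_iff)
  show "\<forall>\<^sub>F n in sequentially. norm ((1 + harm n) ^ N * sqrt (real n) / (real n)\<^sup>2) \<le> ?C * real n powr (-5/4)"
  proof (rule eventually_sequentiallyI[of 1])
    fix n :: nat assume n: "n \<ge> 1"
    have h: "(harm n :: real) \<ge> 0" by (rule harm_nonneg)
    have "(1 + harm n) ^ N * sqrt (real n) / (real n)\<^sup>2 \<le>
        ?C * real n powr (1/4) * sqrt (real n) / (real n)\<^sup>2"
      by (intro divide_right_mono mult_right_mono harm_power_le n) auto
    also have "\<dots> = ?C * (real n powr (1/4) * real n powr (1/2) / real n powr 2)"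
      using n by (simp add: powr_half_sqrt)
    also have "real n powr (1/4) * real n powr (1/2) / real n powr 2 = real n powr (-5/4)"
      by (simp only: powr_add[symmetric] powr_diff[symmetric]) simp
    finally show "norm ((1 + harm n) ^ N * sqrt (real n) / (real n)\<^sup>2) \<le> ?C * real n powr (-5/4)"
      using h by simp
  qed
qed

lemma W0_cases:
  assumes "w \<in> W0"
  obtains "w = []" | a v where "w = Lx # a # v"
  using assms by (cases w; cases "tl w") (auto simp: W0_def word_ends_def)

text \<open>A nonempty word of \<open>W0\<close> starts with x and has a second letter; both divide
  by n, so the coefficients are of size n^(-2) up to logarithms. The weight
  \<open>sqrt (real n)\<close> is included to obtain a rate of convergence as t tends to 1.\<close>

lemma summable_Li_weighted:
  assumes "w \<in> W0"
  shows "summable (\<lambda>n. fps_nth (Li w) n * ((1 + harm n) ^ N * sqrt (real n)))"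
  using assms
proof (cases rule: W0_cases)
  case 1
  show ?thesis
    by (rule summable_finite[of "{0}"]) (auto simp: 1)
next
  case (2 a v)
  show ?thesis
  proof (rule summable_comparison_test[OF _ summable_harm_power[of "length v + N"]])
    have "norm (fps_nth (Li w) n * ((1 + harm n) ^ N * sqrt (real n)))
        \<le> (1 + harm n) ^ (length v + N) * sqrt (real n) / (real n)\<^sup>2" for n
    proof -
      have h: "(harm n :: real) \<ge> 0" by (rule harm_nonneg)
      have "fps_nth (Li w) n = fps_nth (Li (a # v)) n / real n"
        by (simp add: 2)
      also have "\<dots> \<le> hsum v n / real n / real n"
        by (intro divide_right_mono Li_Cons_le) auto
      also have "\<dots> \<le> (1 + harm n) ^ length v / real n / real n"
        by (intro divide_right_mono hsum_le_harm) auto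
      finally have "fps_nth (Li w) n \<le> (1 + harm n) ^ length v / (real n)\<^sup>2"
        by (simp add: power2_eq_square)
      then have "fps_nth (Li w) n * ((1 + harm n) ^ N * sqrt (real n))
          \<le> (1 + harm n) ^ length v / (real n)\<^sup>2 * ((1 + harm n) ^ N * sqrt (real n))"
        using h by (intro mult_right_mono) auto
      then show ?thesis
        using h by (simp add: power_add mult_ac)
    qed
    then show "\<exists>N'. \<forall>n\<ge>N'. norm (fps_nth (Li w) n * ((1 + harm n) ^ N * sqrt (real n)))
        \<le> (1 + harm n) ^ (length v + N) * sqrt (real n) / (real n)\<^sup>2"
      by blast
  qed
qed

lemma summable_Li_harm:
  assumes "w \<in> W0"
  shows "summable (\<lambda>n. fps_nth (Li w) n * (1 + harm n) ^ N)"
proof (rule summable_comparison_test_ev[OF _ summable_Li_weighted[OF assms, of N]])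
  show "\<forall>\<^sub>F n in sequentially. norm (fps_nth (Li w) n * (1 + harm n) ^ N)
      \<le> fps_nth (Li w) n * ((1 + harm n) ^ N * sqrt (real n))"
  proof (rule eventually_sequentiallyI[of 1])
    fix n :: nat assume "n \<ge> 1"
    moreover have "(harm n :: real) \<ge> 0" by (rule harm_nonneg)
    ultimately show "norm (fps_nth (Li w) n * (1 + harm n) ^ N)
      \<le> fps_nth (Li w) n * ((1 + harm n) ^ N * sqrt (real n))"
      by (simp add: mult_left_mono mult_le_cancel_left1 abs_mult)
  qed
qed

lemma summable_Li: "w \<in> W0 \<Longrightarrow> summable (fps_nth (Li w))"
  using summable_Li_harm[of w 0] by simp

text \<open>The zeta value of a word of \<open>W0\<close> as an ordinary series over the largest
  summation index; \<open>mzv_indices\<close> identifies it with the unordered sum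
  \<open>mzv\<close>.\<close>

definition zt :: "letter list \<Rightarrow> real" where
  "zt w = suminf (fps_nth (Li w))"

lemma hsum_tendsto_zt: "w \<in> W0 \<Longrightarrow> hsum w \<longlonglongrightarrow> zt w"
  using summable_LIMSEQ'[OF summable_Li[of w]] by (simp add: zt_def hsum_def[abs_def])

lemma hsum_le_zt: "w \<in> W0 \<Longrightarrow> hsum w n \<le> zt w"
  unfolding zt_def hsum_def by (rule sum_le_suminf) (auto intro: summable_Li)

text \<open>The weight increases with n, so the weighted tail is at most the tail of the series with
  the weight inside, which converges by \<open>summable_Li_harm\<close>.\<close>

lemma zt_minus_hsum_tendsto_0:
  assumes "w \<in> W0"
  shows "(\<lambda>n. (zt w - hsum w n) * (1 + harm n) ^ N) \<longlonglongrightarrow> 0"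
proof (rule real_tendsto_sandwich[OF always_eventually always_eventually])
  let ?g = "\<lambda>n. fps_nth (Li w) n * (1 + harm n) ^ N"
  show "\<forall>n. 0 \<le> (zt w - hsum w n) * (1 + harm n) ^ N"
    using hsum_le_zt[OF assms] harm_nonneg[where 'a = real]
    by (intro allI mult_nonneg_nonneg zero_le_power add_nonneg_nonneg) auto
  show "\<forall>n. (zt w - hsum w n) * (1 + harm n) ^ N \<le> suminf ?g - (\<Sum>m\<le>n. ?g m)"
  proof
    fix n
    have g: "summable ?g" and L: "summable (fps_nth (Li w))"
      using assms by (auto intro: summable_Li_harm summable_Li)
    have "(zt w - hsum w n) * (1 + harm n) ^ N = (suminf (\<lambda>i. fps_nth (Li w) (i + Suc n) * (1 + harm n) ^ N))"
      using suminf_mult2[OF summable_ignore_initial_segment[OF L, of "Suc n"], of "(1 + harm n) ^ N"]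
        suminf_minus_initial_segment[OF L, of "Suc n"]
      by (simp add: zt_def hsum_def lessThan_Suc_atMost)
    also have "\<dots> \<le> (suminf (\<lambda>i. ?g (i + Suc n)))"
    proof (rule suminf_le)
      fix i
      show "fps_nth (Li w) (i + Suc n) * (1 + harm n) ^ N \<le> ?g (i + Suc n)"
        using harm_mono[of n "i + Suc n", where 'a = real] harm_nonneg[of n, where 'a = real]
        by (intro mult_left_mono power_mono) auto
      show "summable (\<lambda>i. fps_nth (Li w) (i + Suc n) * (1 + harm n) ^ N)"
        by (intro summable_mult2 summable_ignore_initial_segment L)
      show "summable (\<lambda>i. ?g (i + Suc n))"
        by (rule summable_ignore_initial_segment[OF g])
    qed
    also have "\<dots> = suminf ?g - (\<Sum>m\<le>n. ?g m)"
      using suminf_minus_initial_segment[OF g, of "Suc n"] by (simp add: lessThan_Suc_atMost)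
    finally show "(zt w - hsum w n) * (1 + harm n) ^ N \<le> suminf ?g - (\<Sum>m\<le>n. ?g m)" .
  qed
  show "(\<lambda>n. suminf ?g - (\<Sum>m\<le>n. ?g m)) \<longlonglongrightarrow> 0"
    using tendsto_diff[OF tendsto_const summable_LIMSEQ'[OF summable_Li_harm[OF assms, of N]], of "suminf ?g"]
    by simp
qed simp

section \<open>Multiple zeta values as limits of truncated sums\<close>

definition mzv_idx :: "nat list \<Rightarrow> nat list set" where
  "mzv_idx l = {m. length m = length l \<and> sorted_wrt (>) m \<and> (\<forall>i\<in>set m. i > 0)}"

definition mzv_idx_le :: "nat list \<Rightarrow> nat \<Rightarrow> nat list set" where
  "mzv_idx_le l n = {m \<in> mzv_idx l. \<forall>i\<in>set m. i \<le> n}"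

lemma mzv_idx_le_Cons_0: "mzv_idx_le (k # l) 0 = {}"
  by (auto simp: mzv_idx_le_def mzv_idx_def length_Suc_conv)

lemma mzv_idx_le_Cons_Suc:
  "mzv_idx_le (k # l) (Suc n) = mzv_idx_le (k # l) n \<union> (#) (Suc n) ` mzv_idx_le l n"
proof (intro equalityI subsetI)
  fix m assume m: "m \<in> mzv_idx_le (k # l) (Suc n)"
  then obtain i m' where i: "m = i # m'"
    by (auto simp: mzv_idx_le_def mzv_idx_def length_Suc_conv)
  show "m \<in> mzv_idx_le (k # l) n \<union> (#) (Suc n) ` mzv_idx_le l n"
    using m by (cases "i = Suc n") (fastforce simp: i mzv_idx_le_def mzv_idx_def)+
qed (auto simp: mzv_idx_le_def mzv_idx_def less_Suc_eq_le le_Suc_eq)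

text \<open>Splitting by whether the largest entry is \<open>Suc n\<close> reproduces the recursion
  of \<open>hsum_zletters_Suc\<close>. Finiteness is carried along for the sum over the disjoint
  union.\<close>

lemma sum_mzv_idx_le:
  assumes "\<forall>k\<in>set l. k \<ge> 1"
  shows "finite (mzv_idx_le l n) \<and>
    (\<Sum>m\<in>mzv_idx_le l n. \<Prod>i<length l. 1 / real (m ! i) ^ (l ! i)) = hsum (zword l) n"
  using assms
proof (induction l arbitrary: n)
  case Nil
  have "mzv_idx_le [] n = {[]}" by (auto simp: mzv_idx_le_def mzv_idx_def)
  then show ?case by simp
next
  case (Cons k l)
  then have IH: "finite (mzv_idx_le l n)"
      "(\<Sum>m\<in>mzv_idx_le l n. \<Prod>i<length l. 1 / real (m ! i) ^ (l ! i)) = hsum (zword l) n" for n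
    by auto
  have k: "k \<ge> 1" using Cons.prems by simp
  let ?f = "\<lambda>m. \<Prod>i<length (k # l). 1 / real (m ! i) ^ ((k # l) ! i)"
  show ?case
  proof (induction n)
    case 0
    show ?case by (simp add: mzv_idx_le_Cons_0 zword_Cons)
  next
    case (Suc n)
    have disj: "mzv_idx_le (k # l) n \<inter> (#) (Suc n) ` mzv_idx_le l n = {}"
      by (auto simp: mzv_idx_le_def)
    have "sum ?f (mzv_idx_le (k # l) (Suc n)) =
        sum ?f (mzv_idx_le (k # l) n) + sum ?f ((#) (Suc n) ` mzv_idx_le l n)"
      unfolding mzv_idx_le_Cons_Suc using Suc IH(1) disj by (intro sum.union_disjoint) auto
    also have "sum ?f ((#) (Suc n) ` mzv_idx_le l n) = (\<Sum>m\<in>mzv_idx_le l n. ?f (Suc n # m))"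
      by (subst sum.reindex) (auto simp: inj_on_def)
    also have "\<dots> = hsum (zword l) n / real (Suc n) ^ k"
      by (simp add: prod.lessThan_Suc_shift sum_distrib_left[symmetric] IH(2) sum_divide_distrib[symmetric]
          del: of_nat_Suc prod.lessThan_Suc)
    finally show ?case
      using Suc IH(1)
      by (simp add: mzv_idx_le_Cons_Suc zword_Cons hsum_zletters_Suc[OF k] del: prod.lessThan_Suc of_nat_Suc)
  qed
qed

text \<open>With nonnegative terms each finite sum lies below the sum over some \<open>B n\<close>,
  and each sum over a finite set containing \<open>B n\<close> lies above that over
  \<open>B n\<close>. So the net of finite sums has the limit of the sequence.\<close>

lemma infsum_nonneg_exhaust:
  fixes f :: "'a \<Rightarrow> real"
  assumes nonneg: "\<And>x. x \<in> A \<Longrightarrow> f x \<ge> 0"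
    and B: "\<And>n. finite (B n)" "\<And>n. B n \<subseteq> A" "\<And>X. finite X \<Longrightarrow> X \<subseteq> A \<Longrightarrow> \<exists>n. X \<subseteq> B n"
    and lim: "(\<lambda>n. sum f (B n)) \<longlonglongrightarrow> s" and le: "\<And>n. sum f (B n) \<le> s"
  shows "infsum f A = s"
proof (rule infsumI)
  show "(f has_sum s) A"
    unfolding has_sum_def
  proof (rule increasing_tendsto)
    show "\<forall>\<^sub>F X in finite_subsets_at_top A. sum f X \<le> s"
    proof (rule eventually_finite_subsets_at_top_weakI)
      fix X assume X: "finite X" "X \<subseteq> A"
      then obtain n where "X \<subseteq> B n" using B(3) by blast
      then have "sum f X \<le> sum f (B n)"
        by (intro sum_mono2) (use B(1)[of n] B(2)[of n] nonneg in auto)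
      then show "sum f X \<le> s" using le[of n] by linarith
    qed
    fix x assume "x < s"
    then obtain n where n: "x < sum f (B n)"
      using order_tendstoD(1)[OF lim, of x] by (auto simp: eventually_sequentially)
    have "x < sum f X" if "finite X" "B n \<subseteq> X" "X \<subseteq> A" for X
    proof -
      have "sum f (B n) \<le> sum f X"
        using that nonneg by (intro sum_mono2) auto
      then show ?thesis using n by linarith
    qed
    then show "\<forall>\<^sub>F X in finite_subsets_at_top A. x < sum f X"
      using B unfolding eventually_finite_subsets_at_top by (intro exI[of _ "B n"]) auto
  qed
qed

lemma mzv_eq_zt:
  assumes "\<forall>k\<in>set l. k \<ge> 1" "zword l \<in> W0"
  shows "mzv l = zt (zword l)"
  unfolding mzv_def mzv_idx_def[symmetric]
proof (rule infsum_nonneg_exhaust[where B = "mzv_idx_le l"])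
  show "\<exists>n. X \<subseteq> mzv_idx_le l n" if "finite X" "X \<subseteq> mzv_idx l" for X
  proof -
    have "finite (\<Union>m\<in>X. set m)" using that by simp
    then obtain n where "\<forall>i\<in>(\<Union>m\<in>X. set m). i \<le> n"
      using finite_nat_set_iff_bounded_le by blast
    then have "X \<subseteq> mzv_idx_le l n"
      using that by (auto simp: mzv_idx_le_def)
    then show ?thesis by blast
  qed
qed (use sum_mzv_idx_le[OF assms(1)] hsum_tendsto_zt[OF assms(2)] hsum_le_zt[OF assms(2)]
     in \<open>auto intro!: prod_nonneg simp: mzv_idx_le_def\<close>)

lemma mzv_indices: "w \<in> W0 \<Longrightarrow> mzv (indices w) = zt w"
  using mzv_eq_zt[OF indices_pos, of w] W0_subset_W1 by (auto simp: zword_indices_W1)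

section \<open>Polylogarithms near t = 1\<close>

definition Li_at :: "letter list \<Rightarrow> real \<Rightarrow> real" where
  "Li_at w t = suminf (\<lambda>n. fps_nth (Li w) n * t ^ n)"

lemma summable_Li_at:
  assumes "0 \<le> t" "t < 1"
  shows "summable (\<lambda>n. fps_nth (Li w) n * t ^ n)"
proof (rule summable_comparison_test)
  show "summable (\<lambda>n. t ^ n)" using assms by (simp add: summable_geometric)
  show "\<exists>N. \<forall>n\<ge>N. norm (fps_nth (Li w) n * t ^ n) \<le> t ^ n"
    using assms Li_le_1[of w] by (auto simp: abs_mult intro!: mult_left_le_one_le)
qed

lemma Li_at_Ly:
  assumes "0 \<le> t" "t < 1"
  shows "Li_at [Ly] t = - ln (1 - t)"
proof -
  have *: "fps_nth (Li [Ly]) (Suc n) = 1 / real (Suc n)" for n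
    by (simp add: lessThan_Suc_eq_insert_0 sum.insert_if)
  have "ln (1 - t) = (suminf (\<lambda>n. (-1) ^ n * (1 / real (n + 1)) * (1 - t - 1) ^ Suc n))"
    using assms by (intro ln_series) auto
  also have "\<dots> = (suminf (\<lambda>n. - (fps_nth (Li [Ly]) (Suc n) * t ^ Suc n)))"
  proof (rule suminf_cong)
    fix n
    have "(-1) ^ n * (- t) ^ Suc n = - (t ^ Suc n)"
      by (simp add: power_minus[of t])
    then have "(-1) ^ n * (1 / real (n + 1)) * (- t) ^ Suc n = (1 / real (n + 1)) * - (t ^ Suc n)"
      by (metis mult.assoc mult.commute)
    then show "(-1) ^ n * (1 / real (n + 1)) * (1 - t - 1) ^ Suc n = - (fps_nth (Li [Ly]) (Suc n) * t ^ Suc n)"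
      by (simp add: * del: Li.simps)
  qed
  also have "\<dots> = - (suminf (\<lambda>n. fps_nth (Li [Ly]) (Suc n) * t ^ Suc n))"
    using summable_Li_at[OF assms, of "[Ly]"] by (intro suminf_minus) (subst summable_Suc_iff)
  also have "(suminf (\<lambda>n. fps_nth (Li [Ly]) (Suc n) * t ^ Suc n)) = Li_at [Ly] t"
    using suminf_split_head[OF summable_Li_at[OF assms, of "[Ly]"]] by (simp add: Li_at_def del: Li.simps)
  finally show ?thesis by simp
qed

text \<open>By Bernoulli, 1 - t^n is at most n (1 - t), and it is at most 1; hence it is at most the
  square root of n (1 - t). Summing against the coefficients gives the constant, finite by
  \<open>summable_Li_weighted\<close>.\<close>

lemma zt_minus_Li_at:
  assumes "w \<in> W0"
  obtains C where "C \<ge> 0" "\<And>t. 0 \<le> t \<Longrightarrow> t < 1 \<Longrightarrow> \<bar>Li_at w t - zt w\<bar> \<le> C * sqrt (1 - t)"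
proof
  have sq: "summable (\<lambda>n. fps_nth (Li w) n * sqrt (real n))"
    using summable_Li_weighted[OF assms, of 0] by simp
  let ?C = "suminf (\<lambda>n. fps_nth (Li w) n * sqrt (real n))"
  show "?C \<ge> 0" by (rule suminf_nonneg[OF sq]) auto
  fix t :: real assume t: "0 \<le> t" "t < 1"
  have 1: "1 - t ^ n \<le> sqrt (real n) * sqrt (1 - t)" for n
  proof -
    have "1 + real n * (t - 1) \<le> (1 + (t - 1)) ^ n"
      using t by (intro Bernoulli_inequality) auto
    then have "1 - t ^ n \<le> real n * (1 - t)" by (simp add: algebra_simps)
    moreover have "0 \<le> 1 - t ^ n" "1 - t ^ n \<le> 1" using t by (auto simp: power_le_one)
    ultimately have "(1 - t ^ n)\<^sup>2 \<le> real n * (1 - t)"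
      by (smt (verit) mult_left_le power2_eq_square)
    then show ?thesis
      by (metis real_le_rsqrt real_sqrt_mult)
  qed
  have d: "zt w - Li_at w t = (suminf (\<lambda>n. fps_nth (Li w) n * (1 - t ^ n)))"
    unfolding zt_def Li_at_def
    by (subst suminf_diff) (auto intro: summable_Li assms summable_Li_at t simp: right_diff_distrib)
  have s: "summable (\<lambda>n. fps_nth (Li w) n * (1 - t ^ n))"
    using summable_diff[OF summable_Li[OF assms] summable_Li_at[OF t, of w]] by (simp add: right_diff_distrib)
  have "zt w - Li_at w t \<le> (suminf (\<lambda>n. fps_nth (Li w) n * sqrt (real n) * sqrt (1 - t)))"
    unfolding d by (rule suminf_le[OF _ s summable_mult2[OF sq]]) (use 1 in \<open>simp add: mult.assoc mult_left_mono\<close>)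
  also have "\<dots> = ?C * sqrt (1 - t)"
    by (rule suminf_mult2[OF sq, symmetric])
  moreover have "0 \<le> zt w - Li_at w t"
    unfolding d by (rule suminf_nonneg[OF s]) (use t in \<open>auto simp: power_le_one\<close>)
  ultimately show "\<bar>Li_at w t - zt w\<bar> \<le> ?C * sqrt (1 - t)" by linarith
qed

lemma eventually_at_left_1: "\<forall>\<^sub>F t :: real in at_left 1. 0 \<le> t \<and> t < 1"
  by (rule eventually_at_leftI[of 0]) auto

text \<open>The value at y is - ln (1 - t), whose powers are at most a constant times (1 -
  t)^(-1/4). Against the error of order (1 - t)^(1/2) this leaves (1 - t)^(1/4).\<close>

lemma zt_minus_Li_at_tendsto_0:
  assumes "w \<in> W0"
  shows "((\<lambda>t. (Li_at w t - zt w) * Li_at [Ly] t ^ k) \<longlongrightarrow> 0) (at_left 1)"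
proof -
  obtain C where C: "C \<ge> 0" "\<And>t. 0 \<le> t \<Longrightarrow> t < 1 \<Longrightarrow> \<bar>Li_at w t - zt w\<bar> \<le> C * sqrt (1 - t)"
    using zt_minus_Li_at[OF assms] by blast
  let ?K = "C * (fact k * 4 ^ k)"
  have "((\<lambda>t::real. 1 - t) \<longlongrightarrow> 0) (at_left 1)"
    by (auto intro!: tendsto_eq_intros)
  then have "((\<lambda>t::real. (1 - t) powr (1/4)) \<longlongrightarrow> 0) (at_left 1)"
    by (rule tendsto_zero_powrI)
       (auto intro!: tendsto_eq_intros intro: eventually_mono[OF eventually_at_left_1])
  then have lim: "((\<lambda>t::real. ?K * (1 - t) powr (1/4)) \<longlongrightarrow> 0) (at_left 1)"
    by (rule tendsto_mult_right_zero)
  show ?thesis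
  proof (rule Lim_null_comparison[OF _ lim], rule eventually_mono[OF eventually_at_left_1])
    fix t :: real assume "0 \<le> t \<and> t < 1"
    then have t: "0 \<le> t" "t < 1" by auto
    have L: "Li_at [Ly] t \<ge> 0" using t by (simp add: Li_at_Ly)
    have "Li_at [Ly] t ^ k \<le> fact k * 4 ^ k * exp (Li_at [Ly] t / 4)"
      by (rule power_le_exp[OF L])
    also have "exp (Li_at [Ly] t / 4) = (1 - t) powr (-1/4)"
      using t by (simp add: Li_at_Ly powr_def)
    finally have "norm ((Li_at w t - zt w) * Li_at [Ly] t ^ k) \<le>
        (C * sqrt (1 - t)) * (fact k * 4 ^ k * (1 - t) powr (-1/4))"
      using L C(2)[OF t] C(1) t by (simp add: abs_mult) (intro mult_mono; simp)
    also have "\<dots> = ?K * ((1 - t) powr (1/2) * (1 - t) powr (-1/4))"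
      using t by (simp add: powr_half_sqrt)
    also have "(1 - t) powr (1/2) * (1 - t) powr (-1/4) = (1 - t) powr (1/4)"
      by (simp add: powr_add[symmetric])
    finally show "norm ((Li_at w t - zt w) * Li_at [Ly] t ^ k) \<le> ?K * (1 - t) powr (1/4)" .
  qed
qed

lemma Li_at_Ly_at_top: "filterlim (Li_at [Ly]) at_top (at_left 1)"
proof -
  have "filterlim (\<lambda>t::real. 1 - t) (at_right 0) (at_left 1)"
    unfolding filterlim_at
    by (auto intro!: tendsto_eq_intros eventually_at_leftI[of 0])
  then have "filterlim (\<lambda>t::real. - ln (1 - t)) at_top (at_left 1)"
    using filterlim_compose[OF ln_at_0] by (auto simp: filterlim_uminus_at_top)
  then show ?thesis
    by (rule filterlim_cong[THEN iffD1, rotated -1]) (auto intro: eventually_mono[OF eventually_at_left_1] simp: Li_at_Ly)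
qed

lemma hsum_Ly: "hsum [Ly] n = harm n"
  by (induction n) (simp_all add: hsum_Suc harm_Suc sum.lessThan_Suc_shift inverse_eq_divide del: sum.lessThan_Suc, simp_all add: harm_def)

lemma hsum_Ly_at_top: "filterlim (hsum [Ly]) at_top sequentially"
proof -
  have "filterlim (\<lambda>n. ln (real n + 1)) at_top sequentially"
    by (rule filterlim_compose[OF ln_at_top]) 
       (rule filterlim_tendsto_add_at_top[where f = "\<lambda>_. 1", THEN filterlim_cong[THEN iffD1, rotated -1]],
        auto intro: filterlim_real_sequentially)
  then show ?thesis
    by (rule filterlim_at_top_mono) (auto simp: hsum_Ly ln_le_harm)
qed

lemma zt_minus_hsum_tendsto_0':
  assumes "w \<in> W0"
  shows "(\<lambda>n. (hsum w n - zt w) * hsum [Ly] n ^ k) \<longlonglongrightarrow> 0"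
proof (rule Lim_null_comparison[OF _ zt_minus_hsum_tendsto_0[OF assms, of k]], rule always_eventually, rule allI)
  fix n
  show "norm ((hsum w n - zt w) * hsum [Ly] n ^ k) \<le> (zt w - hsum w n) * (1 + harm n) ^ k"
    using hsum_le_zt[OF assms, of n] harm_nonneg[of n, where 'a = real]
    by (simp add: abs_mult hsum_Ly mult_left_mono power_mono)
qed

section \<open>Regularization by asymptotic expansion\<close>

text \<open>Since \<open>y \<bullet> y\<^sup>m v = (m + 1) y\<^sup>m\<^sup>+\<^sup>1 v\<close> up to words with at most \<open>m\<close> leading letters \<open>y\<close>, the value at
  \<open>y w\<close> of a homomorphism is determined by its values at words with at most as many leading \<open>y\<close> as \<open>w\<close>.\<close>

lemma lead_induct [consumes 1, case_names W0 Ly]: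
  assumes "w \<in> W1"
    and "\<And>w. w \<in> W0 \<Longrightarrow> Q w"
    and "\<And>w. w \<in> W1 \<Longrightarrow> (\<And>v. v \<in> W1 \<Longrightarrow> lead v \<le> lead w \<Longrightarrow> Q v) \<Longrightarrow> Q (Ly # w)"
  shows "Q w"
  using assms(1)
proof (induction "lead w" arbitrary: w rule: less_induct)
  case less
  show ?case
  proof (cases "w \<in> W0")
    case False
    then obtain v where v: "w = Ly # v"
      using less.prems by (cases w; cases "hd w") (auto simp: W0_def W1_def)
    then have "v \<in> W1"
      using less.prems by (auto simp: W1_def word_ends_Cons)
    then show ?thesis
      unfolding v by (rule assms(3)) (use less.hyps v in auto)
  qed (rule assms(2))
qed

text \<open>Peels off the constant coefficient \<open>a\<close>: subtracting it and dividing by T,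
  which tends to infinity, leaves the polynomial \<open>P\<close> in T, still tending to 0. By
  induction \<open>P\<close> is 0, and then so is \<open>a\<close>.\<close>

lemma poly_tendsto_0_imp_0:
  fixes P :: "real poly"
  assumes "F \<noteq> bot" "filterlim T at_top F" "((\<lambda>i. poly P (T i)) \<longlongrightarrow> 0) F"
  shows "P = 0"
  using assms(3)
proof (induction P)
  case (pCons a P)
  have inv: "((\<lambda>i. inverse (T i)) \<longlongrightarrow> 0) F"
    by (rule tendsto_inverse_0_at_top[OF assms(2)])
  have "((\<lambda>i. (poly (pCons a P) (T i) - a) * inverse (T i)) \<longlongrightarrow> (0 - a) * 0) F"
    by (intro tendsto_intros inv pCons.prems)
  then have "((\<lambda>i. (poly (pCons a P) (T i) - a) * inverse (T i)) \<longlongrightarrow> 0) F"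
    by (simp only: mult_zero_right)
  moreover have "\<forall>\<^sub>F i in F. (poly (pCons a P) (T i) - a) * inverse (T i) = poly P (T i)"
    using eventually_gt_at_top[of 0, THEN assms(2)[unfolded filterlim_iff, rule_format]]
    by eventually_elim simp
  ultimately have "((\<lambda>i. poly P (T i)) \<longlongrightarrow> 0) F"
    by (rule Lim_transform_eventually)
  then have "P = 0" by (rule pCons.IH)
  with pCons.prems have "((\<lambda>i. a) \<longlongrightarrow> 0) F" by simp
  then have "a = 0"
    using tendsto_const_iff[OF assms(1)] by blast
  with \<open>P = 0\<close> show ?case by simp
qed simp

section \<open>Uniqueness of the regularization\<close>

lemma words_in_H1 [simp]: "word w \<in> H1 \<longleftrightarrow> w \<in> W1"
  by (simp add: H1_eq)

lemma H1_add: "p \<in> H1 \<Longrightarrow> q \<in> H1 \<Longrightarrow> p + q \<in> H1"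
  by (simp add: H1_eq keys_add_subset)

lemma H1_scale: "p \<in> H1 \<Longrightarrow> scale c p \<in> H1"
  using keys_scale[of c p] by (auto simp: H1_eq)

lemma zero_in_H1 [simp]: "0 \<in> H1"
  by (simp add: H1_eq)

lemma Zmap_word [simp]: "Zmap (word w) = mzv (indices w)"
  by (simp add: Zmap_def lookup_word)

lemma Ly_in_W1 [simp]: "[Ly] \<in> W1"
  by (simp add: W1_def word_ends_def)

text \<open>Applied to the product of y and \<open>w\<close>, a regularization determines
  \<open>Suc (lead w)\<close> times its value at \<open>Ly # w\<close> from its values at
  \<open>w\<close> and at the remainder, whose words have at most \<open>lead w\<close> leading y.
  The positive factor can be divided out. Off \<open>H1\<close> extensionality fixes the
  values.\<close>

lemma is_regularization_unique:
  assumes f: "is_regularization b f" and g: "is_regularization b g"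
  shows "f = g"
proof -
  have add: "h (p + q) = h p + h q" if "is_regularization b h" "p \<in> H1" "q \<in> H1" for h p q
    using that unfolding is_regularization_def by blast
  have sc: "h (scale c p) = smult (of_rat c) (h p)" if "is_regularization b h" "p \<in> H1" for h p c
    using that unfolding is_regularization_def by blast
  have mult: "h (nc_prod b p q) = h p * h q" if "is_regularization b h" "p \<in> H1" "q \<in> H1" for h p q
    using that unfolding is_regularization_def by blast
  have adm: "h (word w) = [:mzv (indices w):]" if "is_regularization b h" "w \<in> W0" for h w
    using that unfolding is_regularization_def by (auto simp: H0_eq)
  have gen: "h (word [Ly]) = [:0, 1:]" if "is_regularization b h" for h
    using that unfolding is_regularization_def by blast
  have zero: "h 0 = 0" if "is_regularization b h" for h
    using add[OF that, of 0 0] by simp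
  \<comment> \<open>The set \<open>K\<close> is left open because during the induction agreement is
    known only on words with few leading y.\<close>
  have span: "f p = g p" if "Poly_Mapping.keys p \<subseteq> K" "K \<subseteq> W1" "\<And>w. w \<in> K \<Longrightarrow> f (word w) = g (word w)" for p K
  proof -
    have "p \<in> {p \<in> H1. f p = g p}"
      by (rule keys_subset_span[OF _ _ _ _ that(1)])
         (use that(2,3) in \<open>auto simp: zero[OF f] zero[OF g] add[OF f] add[OF g] sc[OF f] sc[OF g] H1_add H1_scale\<close>)
    then show ?thesis by simp
  qed
  have words: "f (word w) = g (word w)" if "w \<in> W1" for w
    using that
  proof (induction w rule: lead_induct)
    case (W0 w)
    then show ?case by (simp add: adm[OF f] adm[OF g])
  next
    case (Ly w)
    obtain r where r: "nc_prod b (word [Ly]) (word w) = scale (of_nat (Suc (lead w))) (word (Ly # w)) + r"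
      "Poly_Mapping.keys r \<subseteq> {v \<in> W1. lead v \<le> lead w}"
      using nc_prod_Ly[OF Ly.hyps] by blast
    have rH: "r \<in> H1" using r(2) by (auto simp: H1_eq)
    have LyH: "word (Ly # w) \<in> H1"
      using Ly_Cons_W1[OF Ly.hyps] by (simp add: word_ends_imp_W1)
    have "[:0, 1:] * h (word w) = smult (of_rat (of_nat (Suc (lead w)))) (h (word (Ly # w))) + h r"
      if h: "is_regularization b h" for h
      using mult[OF h, of "word [Ly]" "word w"] Ly.hyps
      by (simp add: r(1) add[OF h H1_scale[OF LyH] rH] sc[OF h LyH] gen[OF h] del: of_nat_Suc)
    from this[OF f] this[OF g] have
      "smult (of_rat (of_nat (Suc (lead w)))) (f (word (Ly # w))) + f r =
       smult (of_rat (of_nat (Suc (lead w)))) (g (word (Ly # w))) + g r"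
      using Ly.IH[of w] Ly.hyps by simp
    moreover have "f r = g r"
      by (rule span[OF r(2)]) (use Ly.IH in auto)
    ultimately have "smult (real (Suc (lead w))) (f (word (Ly # w))) = smult (real (Suc (lead w))) (g (word (Ly # w)))"
      by (simp del: of_nat_Suc)
    from arg_cong[OF this, of "smult (1 / real (Suc (lead w)))"] show ?case
      by (simp del: of_nat_Suc)
  qed
  show ?thesis
  proof
    fix p show "f p = g p"
    proof (cases "p \<in> H1")
      case True
      then show ?thesis using span[of p W1] words by (simp add: H1_eq)
    next
      case False
      then show ?thesis
        using f g unfolding is_regularization_def by (metis extensional_arb)
    qed
  qed
qed

section \<open>Existence of the regularization\<close>

lemma sum_const_poly: "(\<Sum>x\<in>A. [:g x:]) = [:\<Sum>x\<in>A. g x:]"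
  by (induction A rule: infinite_finite_induct) auto

lemma nc_prod_eq_bilin: "nc_prod b p q = bilin (\<lambda>u v. nc_prod b (word u) (word v)) p q"
  by (cases b) simp_all

text \<open>\<open>V w i\<close> is the value of the word \<open>w\<close> at the cut-off
  \<open>i\<close>, and \<open>V [Ly]\<close> plays the role of T. Multiplicativity is asked only
  eventually along \<open>F\<close>, since for power series it holds for t in [0, 1).\<close>

locale asymptotic_valuation =
  fixes b :: prod_kind and V :: "letter list \<Rightarrow> 'i \<Rightarrow> real" and F :: "'i filter"
  assumes F_neq_bot: "F \<noteq> bot"
    and Ly_at_top: "filterlim (V [Ly]) at_top F"
    and V_mult: "u \<in> W1 \<Longrightarrow> v \<in> W1 \<Longrightarrow>
      \<forall>\<^sub>F i in F. rlin (\<lambda>w. V w i) (nc_prod b (word u) (word v)) = V u i * V v i"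
    and V_W0: "w \<in> W0 \<Longrightarrow> ((\<lambda>i. (V w i - zt w) * V [Ly] i ^ k) \<longlongrightarrow> 0) F"
begin

text \<open>The error has to beat every power of T. This makes the relation stable under
  multiplication by polynomials in T and hence under products.\<close>

definition apx :: "('i \<Rightarrow> real) \<Rightarrow> real poly \<Rightarrow> bool" where
  "apx f P \<longleftrightarrow> (\<forall>k. ((\<lambda>i. (f i - poly P (V [Ly] i)) * V [Ly] i ^ k) \<longlongrightarrow> 0) F)"

lemma apx_tendsto: "apx f P \<Longrightarrow> ((\<lambda>i. f i - poly P (V [Ly] i)) \<longlongrightarrow> 0) F"
  by (drule apx_def[THEN iffD1, THEN spec[of _ 0]]) simp

lemma apx_unique:
  assumes "apx f P" "apx f Q"
  shows "P = Q"
proof -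
  have "((\<lambda>i. (f i - poly Q (V [Ly] i)) - (f i - poly P (V [Ly] i))) \<longlongrightarrow> 0 - 0) F"
    by (intro tendsto_diff apx_tendsto assms)
  then have "((\<lambda>i. poly (P - Q) (V [Ly] i)) \<longlongrightarrow> 0) F" by simp
  then have "P - Q = 0"
    by (rule poly_tendsto_0_imp_0[OF F_neq_bot Ly_at_top])
  then show ?thesis by simp
qed

lemma apx_cong:
  assumes "apx f P" and eq: "\<forall>\<^sub>F i in F. f i = g i"
  shows "apx g P"
  unfolding apx_def
proof
  fix k
  have "((\<lambda>i. (f i - poly P (V [Ly] i)) * V [Ly] i ^ k) \<longlongrightarrow> 0) F"
    using assms(1) unfolding apx_def by blast
  moreover from eq have "\<forall>\<^sub>F i in F. (f i - poly P (V [Ly] i)) * V [Ly] i ^ k =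
      (g i - poly P (V [Ly] i)) * V [Ly] i ^ k"
    by eventually_elim simp
  ultimately show "((\<lambda>i. (g i - poly P (V [Ly] i)) * V [Ly] i ^ k) \<longlongrightarrow> 0) F"
    by (rule Lim_transform_eventually)
qed

lemma apx_poly: "apx (\<lambda>i. poly P (V [Ly] i)) P"
  by (simp add: apx_def)

lemma apx_add:
  assumes "apx f P" "apx g Q"
  shows "apx (\<lambda>i. f i + g i) (P + Q)"
  unfolding apx_def
proof
  fix k
  have "((\<lambda>i. (f i - poly P (V [Ly] i)) * V [Ly] i ^ k + (g i - poly Q (V [Ly] i)) * V [Ly] i ^ k) \<longlongrightarrow> 0 + 0) F"
    using assms unfolding apx_def by (intro tendsto_add) auto
  then show "((\<lambda>i. (f i + g i - poly (P + Q) (V [Ly] i)) * V [Ly] i ^ k) \<longlongrightarrow> 0) F"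
    by (simp add: algebra_simps)
qed

lemma apx_times_poly:
  assumes "apx f P"
  shows "((\<lambda>i. (f i - poly P (V [Ly] i)) * poly Q (V [Ly] i) * V [Ly] i ^ k) \<longlongrightarrow> 0) F"
proof (induction Q arbitrary: k)
  case (pCons a Q)
  have "((\<lambda>i. a * ((f i - poly P (V [Ly] i)) * V [Ly] i ^ k) +
      (f i - poly P (V [Ly] i)) * poly Q (V [Ly] i) * V [Ly] i ^ Suc k) \<longlongrightarrow> a * 0 + 0) F"
    using assms pCons.IH[of "Suc k"] unfolding apx_def by (intro tendsto_intros) auto
  then show ?case by (simp add: algebra_simps)
qed simp

lemma apx_mult:
  assumes "apx f P" "apx g Q"
  shows "apx (\<lambda>i. f i * g i) (P * Q)"
  unfolding apx_def
proof
  fix k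
  let ?T = "V [Ly]"
  \<comment> \<open>From f g - P Q = (f - P) (g - Q) + (f - P) Q + (g - Q) P; the last two terms are
    covered by \<open>apx_times_poly\<close>.\<close>
  have "((\<lambda>i. ((f i - poly P (?T i)) * ?T i ^ k) * (g i - poly Q (?T i)) +
      (f i - poly P (?T i)) * poly Q (?T i) * ?T i ^ k +
      (g i - poly Q (?T i)) * poly P (?T i) * ?T i ^ k) \<longlongrightarrow> 0 * 0 + 0 + 0) F"
    using assms(1) by (intro tendsto_intros apx_times_poly apx_tendsto assms) (auto simp: apx_def)
  then show "((\<lambda>i. (f i * g i - poly (P * Q) (?T i)) * ?T i ^ k) \<longlongrightarrow> 0) F"
    by (simp add: algebra_simps)
qed

lemma apx_cmult: "apx f P \<Longrightarrow> apx (\<lambda>i. c * f i) ([:c:] * P)"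
  using apx_mult[OF apx_poly[of "[:c:]"]] by simp

lemma apx_sum: "(\<And>x. x \<in> A \<Longrightarrow> apx (f x) (P x)) \<Longrightarrow> apx (\<lambda>i. \<Sum>x\<in>A. f x i) (\<Sum>x\<in>A. P x)"
proof (induction A rule: infinite_finite_induct)
  case (insert x A)
  then show ?case by (simp add: apx_add)
qed (use apx_poly[of 0] in simp_all)

lemma apx_lin:
  "(\<And>w. w \<in> Poly_Mapping.keys p \<Longrightarrow> apx (V w) (P w)) \<Longrightarrow> apx (\<lambda>i. rlin (\<lambda>w. V w i) p) (plin P p)"
  unfolding rl.lin_def pl.lin_def by (intro apx_sum apx_cmult)

lemma apx_W0: "w \<in> W0 \<Longrightarrow> apx (V w) [:zt w:]"
  using V_W0 by (simp add: apx_def)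

text \<open>The relation of \<open>nc_prod_Ly\<close> is solved for \<open>V (Ly # w)\<close>. The
  remaining terms have expansions by induction, and expansions are closed under sums, products and
  scalar multiples.\<close>

lemma apx_exists: "w \<in> W1 \<Longrightarrow> \<exists>P. apx (V w) P"
proof (induction w rule: lead_induct)
  case (W0 w)
  then show ?case using apx_W0 by blast
next
  case (Ly w)
  obtain r where r: "nc_prod b (word [Ly]) (word w) = scale (of_nat (Suc (lead w))) (word (Ly # w)) + r"
    "Poly_Mapping.keys r \<subseteq> {v \<in> W1. lead v \<le> lead w}"
    using nc_prod_Ly[OF Ly.hyps] by blast
  define P where "P v = (SOME P. apx (V v) P)" for v
  have P: "apx (V v) (P v)" if "v \<in> W1" "lead v \<le> lead w" for v
    unfolding P_def using Ly.IH[OF that] by (rule someI_ex)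
  let ?m = "real (Suc (lead w))"
  have "apx (\<lambda>i. (1 / ?m) * (V [Ly] i * V w i + - 1 * rlin (\<lambda>w. V w i) r))
      ([:1 / ?m:] * ([:0, 1:] * P w + [:- 1:] * plin P r))"
    using apx_poly[of "[:0, 1:]"] P r(2) Ly.hyps
    by (intro apx_cmult apx_add apx_mult apx_lin) auto
  moreover have "\<forall>\<^sub>F i in F. (1 / ?m) * (V [Ly] i * V w i + - 1 * rlin (\<lambda>w. V w i) r) = V (Ly # w) i"
    using V_mult[OF Ly_in_W1 Ly.hyps]
  proof eventually_elim
    case (elim i)
    then have "V [Ly] i * V w i + - 1 * rlin (\<lambda>w. V w i) r = ?m * V (Ly # w) i"
      by (simp add: r(1) rl.lin_add rl.lin_scale del: of_nat_Suc)
    then show ?case by (simp del: of_nat_Suc)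
  qed
  ultimately show ?case
    using apx_cong by blast
qed

definition expansion :: "letter list \<Rightarrow> real poly" where
  "expansion w = (THE P. apx (V w) P)"

lemma expansion_eqI: "apx (V w) P \<Longrightarrow> expansion w = P"
  unfolding expansion_def using apx_unique by blast

lemma apx_expansion: "w \<in> W1 \<Longrightarrow> apx (V w) (expansion w)"
  using apx_exists expansion_eqI by blast

lemma expansion_W0: "w \<in> W0 \<Longrightarrow> expansion w = [:zt w:]"
  by (intro expansion_eqI apx_W0)

lemma expansion_Ly: "expansion [Ly] = [:0, 1:]"
  using apx_poly[of "[:0, 1:]"] by (intro expansion_eqI) simp

lemma apx_plin_expansion:
  "Poly_Mapping.keys p \<subseteq> W1 \<Longrightarrow> apx (\<lambda>i. rlin (\<lambda>w. V w i) p) (plin expansion p)"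
  by (intro apx_lin apx_expansion) auto

text \<open>Both polynomials expand the same function along \<open>F\<close>, and expansions are
  unique.\<close>

lemma plin_expansion_mult:
  assumes "u \<in> W1" "v \<in> W1"
  shows "plin expansion (nc_prod b (word u) (word v)) = expansion u * expansion v"
proof (rule apx_unique)
  show "apx (\<lambda>i. rlin (\<lambda>w. V w i) (nc_prod b (word u) (word v))) (plin expansion (nc_prod b (word u) (word v)))"
    using assms by (intro apx_plin_expansion keys_nc_prod) auto
  show "apx (\<lambda>i. rlin (\<lambda>w. V w i) (nc_prod b (word u) (word v))) (expansion u * expansion v)"
    by (rule apx_cong[OF apx_mult[OF apx_expansion apx_expansion]])
       (use assms V_mult in \<open>auto simp: eq_commute\<close>)
qed

lemma is_regularization_expansion: "is_regularization b (restrict (plin expansion) H1)"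
  unfolding is_regularization_def
proof (intro conjI ballI allI)
  fix p q assume pq: "p \<in> H1" "q \<in> H1"
  show "restrict (plin expansion) H1 (p + q) = restrict (plin expansion) H1 p + restrict (plin expansion) H1 q"
    using pq by (simp add: H1_add pl.lin_add)
  have "plin expansion (nc_prod b p q) = plin expansion p * plin expansion q"
    unfolding nc_prod_eq_bilin[of b p q]
    by (rule pl.lin_bilin_mult, rule plin_expansion_mult) (use pq in \<open>auto simp: H1_eq\<close>)
  then show "restrict (plin expansion) H1 (nc_prod b p q) =
      restrict (plin expansion) H1 p * restrict (plin expansion) H1 q"
    using pq keys_nc_prod[of p q b] by (simp add: H1_eq)
next
  fix c p assume "p \<in> H1"
  then show "restrict (plin expansion) H1 (scale c p) = smult (of_rat c) (restrict (plin expansion) H1 p)"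
    by (simp add: H1_scale pl.lin_scale)
next
  fix p assume p: "p \<in> H0"
  have "plin expansion p = plin (\<lambda>w. [:mzv (indices w):]) p"
    by (rule pl.lin_cong) (use p in \<open>auto simp: H0_eq expansion_W0 mzv_indices\<close>)
  also have "\<dots> = [:Zmap p:]"
    by (simp add: pl.lin_def Zmap_def sum_const_poly mult.commute)
  finally show "restrict (plin expansion) H1 p = [:Zmap p:]"
    using p W0_subset_W1 by (auto simp: H0_eq H1_eq)
next
  show "restrict (plin expansion) H1 (word [Ly]) = [:0, 1:]"
    by (simp add: expansion_Ly)
qed auto

text \<open>Existence and uniqueness together give the definite description in \<open>Zreg\<close>
  its value.\<close>

lemma Zreg_word: "w \<in> W1 \<Longrightarrow> Zreg b (word w) = expansion w"
proof -
  have "Zreg b = restrict (plin expansion) H1"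
    unfolding Zreg_def using is_regularization_expansion is_regularization_unique by blast
  then show "w \<in> W1 \<Longrightarrow> Zreg b (word w) = expansion w" by simp
qed

end

section \<open>The harmonic and the shuffle valuation\<close>

interpretation harm: asymptotic_valuation Harmonic hsum sequentially
proof
  show "\<forall>\<^sub>F n in sequentially. rlin (\<lambda>w. hsum w n) (nc_prod Harmonic (word u) (word v)) = hsum u n * hsum v n"
    if "u \<in> W1" "v \<in> W1" for u v
    using that rlin_hsum_harm_idx[OF indices_pos indices_pos, of _ u v] by (simp add: zword_indices_W1)
qed (auto intro: hsum_Ly_at_top zt_minus_hsum_tendsto_0')

lemma sums_rlin_Li_at:
  assumes "0 \<le> t" "t < 1"
  shows "(\<lambda>n. rlin (\<lambda>w. fps_nth (Li w) n) p * t ^ n) sums rlin (\<lambda>w. Li_at w t) p"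
proof -
  have "(\<lambda>n. \<Sum>w\<in>Poly_Mapping.keys p. of_rat (Poly_Mapping.lookup p w) * (fps_nth (Li w) n * t ^ n)) sums
      (\<Sum>w\<in>Poly_Mapping.keys p. of_rat (Poly_Mapping.lookup p w) * Li_at w t)"
    unfolding Li_at_def by (intro sums_sum sums_mult summable_sums summable_Li_at assms)
  then show ?thesis
    by (simp add: rl.lin_def sum_distrib_right mult.assoc)
qed

text \<open>The formal identity \<open>flin_Li_sh_word\<close> passes to values at t by the Cauchy
  product of absolutely convergent series.\<close>

lemma Li_at_shuffle:
  assumes "u \<in> W1" "v \<in> W1" "0 \<le> t" "t < 1"
  shows "rlin (\<lambda>w. Li_at w t) (sh_word u v) = Li_at u t * Li_at v t"
proof (rule sums_unique2)
  have "(\<lambda>n. \<Sum>i\<le>n. (fps_nth (Li u) i * t ^ i) * (fps_nth (Li v) (n - i) * t ^ (n - i))) sums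
      (Li_at u t * Li_at v t)"
    unfolding Li_at_def
    by (rule Cauchy_product_sums) (use summable_Li_at assms in \<open>simp_all add: abs_mult\<close>)
  also have "(\<lambda>n. \<Sum>i\<le>n. (fps_nth (Li u) i * t ^ i) * (fps_nth (Li v) (n - i) * t ^ (n - i))) =
      (\<lambda>n. fps_nth (Li u * Li v) n * t ^ n)"
  proof
    fix n
    have "(fps_nth (Li u) i * t ^ i) * (fps_nth (Li v) (n - i) * t ^ (n - i)) =
        fps_nth (Li u) i * fps_nth (Li v) (n - i) * t ^ n" if "i \<le> n" for i
      using that power_add[of t i "n - i"] by simp
    note E = this
    show "(\<Sum>i\<le>n. (fps_nth (Li u) i * t ^ i) * (fps_nth (Li v) (n - i) * t ^ (n - i))) =
        fps_nth (Li u * Li v) n * t ^ n"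
      unfolding fps_mult_nth sum_distrib_right atLeast0AtMost by (intro sum.cong refl E) simp
  qed
  finally show "(\<lambda>n. rlin (\<lambda>w. fps_nth (Li w) n) (sh_word u v) * t ^ n) sums (Li_at u t * Li_at v t)"
    using fps_nth_flin[of Li "sh_word u v"] flin_Li_sh_word[OF assms(1,2)] by simp
qed (rule sums_rlin_Li_at[OF assms(3,4)])

interpretation sh: asymptotic_valuation Shuffle Li_at "at_left 1"
proof
  show "\<forall>\<^sub>F t in at_left 1. rlin (\<lambda>w. Li_at w t) (nc_prod Shuffle (word u) (word v)) = Li_at u t * Li_at v t"
    if "u \<in> W1" "v \<in> W1" for u v
    using eventually_at_left_1 by eventually_elim (simp add: Li_at_shuffle that)
qed (auto intro: Li_at_Ly_at_top zt_minus_Li_at_tendsto_0)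

text \<open>Abel's limit theorem for a series with sum 0. Summation by parts turns f(t) into 1 - t
  times the power series of the partial sums \<open>a n\<close>. The terms below \<open>N\<close>
  disappear with the factor 1 - t, the others contribute at most e/2.\<close>

lemma suminf_power_null:
  fixes c :: "nat \<Rightarrow> real"
  assumes lim: "(\<lambda>n. \<Sum>i\<le>n. c i) \<longlonglongrightarrow> 0"
    and sums: "\<And>t. 0 \<le> t \<Longrightarrow> t < 1 \<Longrightarrow> (\<lambda>n. c n * t ^ n) sums f t"
  shows "(f \<longlongrightarrow> 0) (at_left 1)"
proof (rule tendstoI)
  fix e :: real assume e: "e > 0"
  define a where "a n = (\<Sum>i\<le>n. c i)" for n
  obtain N where N: "\<And>n. n \<ge> N \<Longrightarrow> \<bar>a n\<bar> < e / 2"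
    using lim e unfolding a_def[symmetric] LIMSEQ_iff by (metis half_gt_zero diff_zero real_norm_def)
  have bdd: "\<bar>f t\<bar> \<le> (1 - t) * (\<Sum>n<N. \<bar>a n\<bar>) + e / 2" if t: "0 \<le> t" "t < 1" for t
  proof -
    obtain K where K: "\<And>n. \<bar>a n\<bar> \<le> K"
      using convergent_imp_Bseq[OF convergentI[OF lim]] unfolding a_def[symmetric] Bseq_def by auto
    have geo: "summable (\<lambda>n. t ^ n)" using t by (simp add: summable_geometric)
    have sa: "summable (\<lambda>n. \<bar>a n * t ^ n\<bar>)"
    proof (rule summable_comparison_test[OF _ summable_mult[OF geo, of K]])
      show "\<exists>N. \<forall>n\<ge>N. norm \<bar>a n * t ^ n\<bar> \<le> K * t ^ n"
        using K t by (auto simp: abs_mult intro!: mult_right_mono)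
    qed
    have s0: "(\<lambda>n. a n * t ^ n) sums suminf (\<lambda>n. a n * t ^ n)"
      using summable_rabs_cancel[OF sa] by (rule summable_sums)
    then have "(\<lambda>n. t * (a n * t ^ n)) sums (t * suminf (\<lambda>n. a n * t ^ n))"
      by (rule sums_mult)
    \<comment> \<open>The series shifted by one index; the entry at 0 is 0 because no partial sum
      precedes the first.\<close>
    then have "(\<lambda>n. case n of 0 \<Rightarrow> 0 | Suc m \<Rightarrow> t * (a m * t ^ m)) sums (t * suminf (\<lambda>n. a n * t ^ n))"
      using sums_Suc[of "case_nat 0 (\<lambda>m. t * (a m * t ^ m))" "t * suminf (\<lambda>n. a n * t ^ n)"] by simp
    from sums_diff[OF s0 this] have
      "(\<lambda>n. a n * t ^ n - (case n of 0 \<Rightarrow> 0 | Suc m \<Rightarrow> t * (a m * t ^ m))) sums ((1 - t) * suminf (\<lambda>n. a n * t ^ n))"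
      by (simp add: algebra_simps)
    moreover have "a n * t ^ n - (case n of 0 \<Rightarrow> 0 | Suc m \<Rightarrow> t * (a m * t ^ m)) = c n * t ^ n" for n
      by (cases n) (simp_all add: a_def algebra_simps)
    ultimately have f: "f t = (1 - t) * suminf (\<lambda>n. a n * t ^ n)"
      using sums[OF t] sums_unique2 by fastforce
    have "suminf (\<lambda>n. \<bar>a n * t ^ n\<bar>) \<le> suminf (\<lambda>n. (if n < N then \<bar>a n\<bar> else 0) + e / 2 * t ^ n)"
    proof (rule suminf_le[OF _ sa])
      fix n
      have "t ^ n \<le> 1" "t ^ n \<ge> 0" using t by (auto simp: power_le_one)
      then show "\<bar>a n * t ^ n\<bar> \<le> (if n < N then \<bar>a n\<bar> else 0) + e / 2 * t ^ n"
        using N[of n] e mult_left_le[of "t ^ n" "\<bar>a n\<bar>"] mult_right_mono[of "\<bar>a n\<bar>" "e / 2" "t ^ n"]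
        by (auto simp: abs_mult intro: add_increasing2)
    next
      show "summable (\<lambda>n. (if n < N then \<bar>a n\<bar> else 0) + e / 2 * t ^ n)"
        by (intro summable_add summable_mult geo summable_finite[of "{..<N}"]) auto
    qed
    also have "\<dots> = (\<Sum>n<N. \<bar>a n\<bar>) + e / 2 * (1 / (1 - t))"
    proof -
      have "(\<lambda>n. if n < N then \<bar>a n\<bar> else 0) sums (\<Sum>n<N. \<bar>a n\<bar>)"
        using sums_If_finite_set[of "{..<N}" "\<lambda>n. \<bar>a n\<bar>"] by simp
      moreover have "(\<lambda>n. e / 2 * t ^ n) sums (e / 2 * (1 / (1 - t)))"
        using t by (intro sums_mult geometric_sums) auto
      ultimately show ?thesis
        by (intro sums_unique[symmetric] sums_add)
    qed
    finally have "\<bar>suminf (\<lambda>n. a n * t ^ n)\<bar> \<le> (\<Sum>n<N. \<bar>a n\<bar>) + e / 2 * (1 / (1 - t))"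
      using summable_rabs[OF sa] by linarith
    then have "(1 - t) * \<bar>suminf (\<lambda>n. a n * t ^ n)\<bar> \<le> (1 - t) * ((\<Sum>n<N. \<bar>a n\<bar>) + e / 2 * (1 / (1 - t)))"
      using t by (intro mult_left_mono) auto
    also have "\<dots> = (1 - t) * (\<Sum>n<N. \<bar>a n\<bar>) + e / 2"
      using t by (simp add: field_simps)
    finally show ?thesis
      using t by (simp add: f abs_mult)
  qed
  have "((\<lambda>t::real. (1 - t) * (\<Sum>n<N. \<bar>a n\<bar>)) \<longlongrightarrow> 0) (at_left 1)"
    by (auto intro!: tendsto_eq_intros)
  then have "\<forall>\<^sub>F t in at_left 1. (1 - t) * (\<Sum>n<N. \<bar>a n\<bar>) < e / 2"
    using e by (intro order_tendstoD) auto
  with eventually_at_left_1 show "\<forall>\<^sub>F t in at_left 1. dist (f t) 0 < e"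
  proof eventually_elim
    case (elim t)
    then show ?case using bdd[of t] by simp
  qed
qed

text \<open>The regularized double shuffle relation for an admissible left factor: a harmonic
  product evaluated by the shuffle regularization. The partial sums of \<open>c\<close> factor by
  \<open>rlin_hsum_harm_idx\<close>; the first factor is the tail of a convergent series and beats
  the logarithmic growth of the second.\<close>

lemma plin_expansion_harm_idx:
  assumes u: "\<forall>k\<in>set u. k \<ge> 1" "zword u \<in> W0" and v: "\<forall>k\<in>set v. k \<ge> 1"
  shows "plin sh.expansion (harm_idx u v) = sh.expansion (zword u) * sh.expansion (zword v)"
proof -
  let ?z = "zt (zword u)" and ?T = "Li_at [Ly]" and ?P = "plin sh.expansion (harm_idx u v)"
    and ?Q = "sh.expansion (zword v)"
  define c where "c n = rlin (\<lambda>w. fps_nth (Li w) n) (harm_idx u v) - ?z * fps_nth (Li (zword v)) n" for n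
  have partial: "(\<Sum>i\<le>n. c i) = (hsum (zword u) n - ?z) * hsum (zword v) n" for n
  proof -
    have "(\<Sum>i\<le>n. rlin (\<lambda>w. fps_nth (Li w) i) (harm_idx u v)) = rlin (\<lambda>w. hsum w n) (harm_idx u v)"
      unfolding rl.lin_def hsum_def by (subst sum.swap) (simp add: sum_distrib_left)
    then show ?thesis
      using rlin_hsum_harm_idx[OF u(1) v, of n]
      by (simp add: c_def sum_subtractf sum_distrib_left[symmetric] hsum_def[symmetric] algebra_simps)
  qed
  have "(\<lambda>n. (hsum (zword u) n - ?z) * hsum (zword v) n) \<longlonglongrightarrow> 0"
  proof (rule Lim_null_comparison[OF always_eventually zt_minus_hsum_tendsto_0[OF u(2), of "length (zword v)"]], rule allI)
    fix n
    show "norm ((hsum (zword u) n - ?z) * hsum (zword v) n) \<le> (?z - hsum (zword u) n) * (1 + harm n) ^ length (zword v)"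
      using hsum_le_zt[OF u(2), of n] hsum_le_harm[of "zword v" n] by (simp add: abs_mult mult_left_mono)
  qed
  then have A: "((\<lambda>t. rlin (\<lambda>w. Li_at w t) (harm_idx u v) - ?z * Li_at (zword v) t) \<longlongrightarrow> 0) (at_left 1)"
  proof (intro suminf_power_null[of c])
    fix t :: real assume t: "0 \<le> t" "t < 1"
    have "(\<lambda>n. fps_nth (Li (zword v)) n * t ^ n) sums Li_at (zword v) t"
      unfolding Li_at_def by (intro summable_sums summable_Li_at t)
    from sums_diff[OF sums_rlin_Li_at[OF t, of "harm_idx u v"] sums_mult[OF this, of ?z]]
    show "(\<lambda>n. c n * t ^ n) sums (rlin (\<lambda>w. Li_at w t) (harm_idx u v) - ?z * Li_at (zword v) t)"
      by (simp add: c_def algebra_simps)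
  qed (simp add: partial)
  have B: "((\<lambda>t. rlin (\<lambda>w. Li_at w t) (harm_idx u v) - poly ?P (?T t)) \<longlongrightarrow> 0) (at_left 1)"
    by (intro sh.apx_tendsto sh.apx_plin_expansion keys_harm_idx)
  have C: "((\<lambda>t. ?z * (Li_at (zword v) t - poly ?Q (?T t))) \<longlongrightarrow> ?z * 0) (at_left 1)"
    by (intro tendsto_mult_left sh.apx_tendsto sh.apx_expansion zword_W1)
  \<comment> \<open>In this combination all polylogarithms cancel and a polynomial in T = - ln (1 -
    t) remains.\<close>
  have "((\<lambda>t. (rlin (\<lambda>w. Li_at w t) (harm_idx u v) - ?z * Li_at (zword v) t) -
      (rlin (\<lambda>w. Li_at w t) (harm_idx u v) - poly ?P (?T t)) +
      ?z * (Li_at (zword v) t - poly ?Q (?T t))) \<longlongrightarrow> 0 - 0 + ?z * 0) (at_left 1)"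
    by (rule tendsto_add[OF tendsto_diff[OF A B] C])
  then have "((\<lambda>t. poly (?P - [:?z:] * ?Q) (?T t)) \<longlongrightarrow> 0) (at_left 1)"
    by (simp add: algebra_simps)
  then have "?P - [:?z:] * ?Q = 0"
    by (rule poly_tendsto_0_imp_0[OF sh.F_neq_bot sh.Ly_at_top])
  then show ?thesis
    by (simp add: sh.expansion_W0[OF u(2)])
qed

section \<open>Harmonic relations between regularized values\<close>

definition rmzv_word :: "prod_kind \<Rightarrow> letter list \<Rightarrow> real" where
  "rmzv_word b w = poly (Zreg b (word w)) 0"

lemma rmzv_eq_rmzv_word: "rmzv b l = rmzv_word b (zword l)"
  by (simp add: rmzv_def rmzv_word_def)

lemma zword_in_W0: "l \<noteq> [] \<Longrightarrow> hd l \<ge> 2 \<Longrightarrow> zword l \<in> W0"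
  using word_ends_zletters[OF zword_W1, of "hd l" "tl l"]
  by (cases l; cases "hd l - 1") (auto simp: W0_def zword_Cons zletters_def)

text \<open>Evaluation at T = 0. For \<open>Harmonic\<close> this is the homomorphism property; for
  \<open>Shuffle\<close> it is \<open>plin_expansion_harm_idx\<close>, whence the condition on the
  first index of \<open>u\<close>.\<close>

lemma rlin_rmzv_harm_idx:
  assumes "\<forall>k\<in>set u. k \<ge> 1" "\<forall>k\<in>set v. k \<ge> 1" "b = Harmonic \<or> u \<noteq> [] \<and> hd u \<ge> 2"
  shows "rlin (rmzv_word b) (harm_idx u v) = rmzv b u * rmzv b v"
proof (cases b)
  case Harmonic
  have "rlin (rmzv_word b) (harm_idx u v) = poly (plin harm.expansion (harm_idx u v)) 0"
    unfolding poly_plin rmzv_word_def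
    by (rule rl.lin_cong) (use keys_harm_idx[of u v] in \<open>auto simp: Harmonic harm.Zreg_word\<close>)
  also have "\<dots> = rmzv b u * rmzv b v"
    using harm.plin_expansion_mult[of "zword u" "zword v"] assms
    by (simp add: indices_zword rmzv_def Harmonic harm.Zreg_word)
  finally show ?thesis .
next
  case Shuffle
  have "rlin (rmzv_word b) (harm_idx u v) = poly (plin sh.expansion (harm_idx u v)) 0"
    unfolding poly_plin rmzv_word_def
    by (rule rl.lin_cong) (use keys_harm_idx[of u v] in \<open>auto simp: Shuffle sh.Zreg_word\<close>)
  also have "\<dots> = rmzv b u * rmzv b v"
    using assms Shuffle zword_in_W0[of u]
    by (subst plin_expansion_harm_idx) (auto simp: rmzv_def sh.Zreg_word)
  finally show ?thesis .
qed

lemma rmzv_single: "k \<ge> 2 \<Longrightarrow> rmzv b [k] = mzv [k]"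
  using zword_in_W0[of "[k]"]
  by (cases b) (auto simp: rmzv_def sh.Zreg_word sh.expansion_W0 harm.Zreg_word harm.expansion_W0 mzv_eq_zt)

lemma sh_word_replicate_Ly:
  "sh_word [Ly] (replicate n Ly) = scale (of_nat (Suc n)) (word (replicate (Suc n) Ly))"
proof (induction n)
  case (Suc n)
  then show ?case
    using word_add_scale_of_nat[of "replicate (Suc (Suc n)) Ly" "Suc n"]
    by (simp add: conc_word_scale del: of_nat_Suc)
qed simp

lemma zword_replicate_1: "zword (replicate n 1) = replicate n Ly"
  by (induction n) (simp_all add: zword_Cons)

text \<open>The shuffle of y with y^n is n + 1 times y^(n+1), so n + 1 times the polynomial of
  y^(n+1) is divisible by T and vanishes at T = 0.\<close>

lemma rmzv_Shuffle_ones: "rmzv Shuffle (replicate (Suc n) 1) = 0"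
proof -
  have W1: "replicate m Ly \<in> W1" for m
    using zword_W1[of "replicate m 1"] by (simp only: zword_replicate_1)
  have "plin sh.expansion (nc_prod Shuffle (word [Ly]) (word (replicate n Ly))) =
      [:0, 1:] * sh.expansion (replicate n Ly)"
    by (subst sh.plin_expansion_mult) (simp_all add: W1 sh.expansion_Ly)
  then have "[:of_nat (Suc n):] * sh.expansion (replicate (Suc n) Ly) = [:0, 1:] * sh.expansion (replicate n Ly)"
    by (simp add: sh_word_replicate_Ly pl.lin_scale del: of_nat_Suc replicate_Suc)
  from arg_cong[OF this, of "\<lambda>p. poly p 0"]
  have "poly (sh.expansion (replicate (Suc n) Ly)) 0 = 0"
    by (simp del: of_nat_Suc replicate_Suc)
  then show ?thesis
    using W1[of "Suc n"] by (simp only: rmzv_def zword_replicate_1 sh.Zreg_word)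
qed

section \<open>Cyclic sums\<close>

text \<open>The indices that may open the left factor of a harmonic product in
  \<open>rlin_rmzv_harm_idx\<close>.\<close>

definition adm :: "prod_kind \<Rightarrow> nat \<Rightarrow> bool" where
  "adm b k \<longleftrightarrow> k \<ge> 1 \<and> (b = Harmonic \<or> k \<ge> 2)"

lemma rmzv_stuffle:
  assumes "adm b k" "\<forall>i\<in>set u. i \<ge> 1" "\<forall>i\<in>set v. i \<ge> 1"
  shows "rmzv b (k # u) * rmzv b v = rlin (rmzv_word b) (harm_idx (k # u) v)"
  using rlin_rmzv_harm_idx[of "k # u" v b] assms by (auto simp: adm_def)

section \<open>Harmonic products of small depth\<close>

lemmas stuffle_simps = rmzv_eq_rmzv_word rl.lin_add rl.lin_word_conc zword_Cons

text \<open>In \<open>stuffle_i_j\<close> the numbers i and j are the depths of the two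
  factors.\<close>

lemma stuffle_1_1:
  assumes "adm b k" "l \<ge> 1"
  shows "rmzv b [k] * rmzv b [l] = rmzv b [k, l] + rmzv b [l, k] + rmzv b [k + l]"
  using rmzv_stuffle[of b k "[]" "[l]"] assms by (simp add: stuffle_simps)

lemma stuffle_1_2:
  assumes "adm b k" "l \<ge> 1" "m \<ge> 1"
  shows "rmzv b [k] * rmzv b [l, m] =
    rmzv b [k, l, m] + rmzv b [l, k, m] + rmzv b [l, m, k] + rmzv b [l, k + m]
    + rmzv b [k + l, m]"
  using rmzv_stuffle[of b k "[]" "[l, m]"] assms by (simp add: stuffle_simps)

lemma stuffle_1_3:
  assumes "adm b k" "l \<ge> 1" "m \<ge> 1" "n \<ge> 1"
  shows "rmzv b [k] * rmzv b [l, m, n] =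
    rmzv b [k, l, m, n] + rmzv b [l, k, m, n] + rmzv b [l, m, k, n] + rmzv b [l, m, n, k]
    + rmzv b [l, m, k + n] + rmzv b [l, k + m, n] + rmzv b [k + l, m, n]"
  using rmzv_stuffle[of b k "[]" "[l, m, n]"] assms by (simp add: stuffle_simps)

lemma stuffle_2_1:
  assumes "adm b k" "l \<ge> 1" "m \<ge> 1"
  shows "rmzv b [k, l] * rmzv b [m] =
    rmzv b [k, l, m] + rmzv b [k, m, l] + rmzv b [k, l + m] + rmzv b [m, k, l]
    + rmzv b [k + m, l]"
  using rmzv_stuffle[of b k "[l]" "[m]"] assms by (simp add: stuffle_simps)

lemma stuffle_2_2:
  assumes "adm b k" "l \<ge> 1" "m \<ge> 1" "n \<ge> 1"
  shows "rmzv b [k, l] * rmzv b [m, n] =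
    rmzv b [k, l, m, n] + rmzv b [k, m, l, n] + rmzv b [k, m, n, l] + rmzv b [k, m, l + n]
    + rmzv b [k, l + m, n] + rmzv b [m, k, l, n] + rmzv b [m, k, n, l]
    + rmzv b [m, k, l + n] + rmzv b [m, n, k, l] + rmzv b [m, k + n, l]
    + rmzv b [k + m, l, n] + rmzv b [k + m, n, l] + rmzv b [k + m, l + n]"
  using rmzv_stuffle[of b k "[l]" "[m, n]"] assms by (simp add: stuffle_simps)

lemma stuffle_3_1:
  assumes "adm b k" "l \<ge> 1" "m \<ge> 1" "n \<ge> 1"
  shows "rmzv b [k, l, m] * rmzv b [n] =
    rmzv b [k, l, m, n] + rmzv b [k, l, n, m] + rmzv b [k, l, m + n] + rmzv b [k, n, l, m]
    + rmzv b [k, l + n, m] + rmzv b [n, k, l, m] + rmzv b [k + n, l, m]"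
  using rmzv_stuffle[of b k "[l, m]" "[n]"] assms by (simp add: stuffle_simps)

text \<open>Left side minus right side of the identity with chi = 1. Writing \<open>rmzv\<close>
  also for the single zeta value lets the harmonic relations cancel it; \<open>rmzv_single\<close>
  restores \<open>mzv\<close> at the end.\<close>

definition cyclic_defect3 :: "prod_kind \<Rightarrow> nat \<Rightarrow> nat \<Rightarrow> nat \<Rightarrow> real" where
  "cyclic_defect3 b l1 l2 l3 =
     rmzv b [l1, l2, l3] + rmzv b [l2, l3, l1] + rmzv b [l3, l1, l2]
     - (- (rmzv b [l1] * rmzv b [l2] * rmzv b [l3])
        + rmzv b [l1, l2] * rmzv b [l3]
        + rmzv b [l2, l3] * rmzv b [l1]
        + rmzv b [l3, l1] * rmzv b [l2]
        + rmzv b [l1 + l2 + l3])"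

definition cyclic_defect4 :: "prod_kind \<Rightarrow> nat \<Rightarrow> nat \<Rightarrow> nat \<Rightarrow> nat \<Rightarrow> real" where
  "cyclic_defect4 b l1 l2 l3 l4 =
     rmzv b [l1, l2, l3, l4] + rmzv b [l2, l3, l4, l1]
     + rmzv b [l3, l4, l1, l2] + rmzv b [l4, l1, l2, l3]
     - (rmzv b [l1] * rmzv b [l2] * rmzv b [l3] * rmzv b [l4]
        - rmzv b [l1, l2] * rmzv b [l3] * rmzv b [l4]
        - rmzv b [l2, l3] * rmzv b [l4] * rmzv b [l1]
        - rmzv b [l3, l4] * rmzv b [l1] * rmzv b [l2]
        - rmzv b [l4, l1] * rmzv b [l2] * rmzv b [l3]
        + rmzv b [l1, l2] * rmzv b [l3, l4]
        + rmzv b [l2, l3] * rmzv b [l4, l1]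
        + rmzv b [l1, l2, l3] * rmzv b [l4]
        + rmzv b [l2, l3, l4] * rmzv b [l1]
        + rmzv b [l3, l4, l1] * rmzv b [l2]
        + rmzv b [l4, l1, l2] * rmzv b [l3]
        - rmzv b [l1 + l2 + l3 + l4])"

text \<open>Cyclic symmetry allows an admissible index to be moved to the first place.\<close>

lemma cyclic_defect3_rotate: "cyclic_defect3 b l1 l2 l3 = cyclic_defect3 b l2 l3 l1"
  unfolding cyclic_defect3_def by (simp add: ac_simps)

lemma cyclic_defect4_rotate: "cyclic_defect4 b l1 l2 l3 l4 = cyclic_defect4 b l2 l3 l4 l1"
  unfolding cyclic_defect4_def by (simp add: ac_simps)

text \<open>In the following lemmas the digits in the name tell which indices are admissible (\<open>2\<close>) and which are
  equal to one common \<open>u\<close> (\<open>1\<close>); \<open>u\<close> will be \<open>1\<close>. The products that are expanded were found by solving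
  a linear system.\<close>

lemma cyclic_defect3_211:
  assumes adm_p: "adm b p" and pos_u: "u \<ge> 1"
    and zero: "rmzv b [u] = 0" "rmzv b [u, u] = 0"
  shows "cyclic_defect3 b p u u = 0"
proof -
  have adm_up: "adm b (u + p)"
    using assms by (auto simp: adm_def)
  \<comment> \<open>The products in the defect vanish. Expanding
    \<open>rmzv b [p] * rmzv b [u, u]\<close> shows that the cyclic sum is minus the values at
    \<open>[u, u + p]\<close> and \<open>[u + p, u]\<close>; expanding
    \<open>rmzv b [u + p] * rmzv b [u]\<close> shows that those two add up to minus the single zeta
    value.\<close>
  show ?thesis
    using stuffle_1_1[OF adm_up pos_u]
      stuffle_1_2[OF adm_p pos_u pos_u]
    unfolding cyclic_defect3_def
    by (simp (no_asm_use) only: algebra_simps zero mult_zero_left mult_zero_right)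
qed

lemma cyclic_defect3_221:
  assumes adm_p: "adm b p" and adm_q: "adm b q" and pos_u: "u \<ge> 1"
    and zero: "rmzv b [u] = 0"
  shows "cyclic_defect3 b p q u = 0"
proof -
  have adm_pq: "adm b (p + q)"
    using assms by (auto simp: adm_def)
  have pos_p: "p \<ge> 1" and pos_q: "q \<ge> 1"
    using assms by (auto simp: adm_def)
  show ?thesis
    using stuffle_1_2[OF adm_p pos_q pos_u]
      stuffle_1_1[OF adm_pq pos_u]
      stuffle_1_2[OF adm_q pos_u pos_p]
      stuffle_2_1[OF adm_q pos_p pos_u]
    unfolding cyclic_defect3_def
    by (simp (no_asm_use) only: algebra_simps zero mult_zero_left mult_zero_right)
qed

lemma cyclic_defect3_222:
  assumes adm_p: "adm b p" and adm_q: "adm b q" and adm_r: "adm b r"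
  shows "cyclic_defect3 b p q r = 0"
proof -
  have adm_pq: "adm b (p + q)"
    using assms by (auto simp: adm_def)
  have pos_p: "p \<ge> 1" and pos_q: "q \<ge> 1" and pos_r: "r \<ge> 1"
    using assms by (auto simp: adm_def)
  show ?thesis
    using stuffle_1_2[OF adm_p pos_q pos_r]
      stuffle_1_1[OF adm_pq pos_r]
      stuffle_1_2[OF adm_q pos_r pos_p]
      stuffle_2_1[OF adm_q pos_p pos_r]
      \<comment> \<open>The triple product in the defect enters by multiplying a product of two
        depth-one values by the third.\<close>
      arg_cong[OF stuffle_1_1[OF adm_p pos_q], of "\<lambda>t. t * (rmzv b [r])"]
    unfolding cyclic_defect3_def
    by (simp (no_asm_use) only: algebra_simps)
qed

lemma cyclic_defect4_2111:
  assumes adm_p: "adm b p" and pos_u: "u \<ge> 1"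
    and zero: "rmzv b [u] = 0" "rmzv b [u, u] = 0" "rmzv b [u, u, u] = 0"
  shows "cyclic_defect4 b p u u u = 0"
proof -
  have adm_up: "adm b (u + p)" and adm_uup: "adm b (u + u + p)"
    using assms by (auto simp: adm_def)
  \<comment> \<open>Three vanishing products telescope: the terms in which one \<open>u\<close> is
    merged into \<open>p\<close> are the unmerged terms of the next product, until only the single
    zeta value is left.\<close>
  show ?thesis
    using stuffle_1_1[OF adm_uup pos_u]
      stuffle_1_2[OF adm_up pos_u pos_u]
      stuffle_1_3[OF adm_p pos_u pos_u pos_u]
    unfolding cyclic_defect4_def
    by (simp (no_asm_use) only: algebra_simps zero mult_zero_left mult_zero_right)
qed

lemma cyclic_defect4_2211:
  assumes adm_p: "adm b p" and adm_q: "adm b q" and pos_u: "u \<ge> 1"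
    and zero: "rmzv b [u] = 0" "rmzv b [u, u] = 0"
  shows "cyclic_defect4 b p q u u = 0"
proof -
  have adm_pq: "adm b (p + q)" and adm_upq: "adm b (u + p + q)"
    using assms by (auto simp: adm_def)
  have pos_p: "p \<ge> 1" and pos_q: "q \<ge> 1"
    using assms by (auto simp: adm_def)
  show ?thesis
    using stuffle_1_1[OF adm_upq pos_u]
      stuffle_1_3[OF adm_p pos_q pos_u pos_u]
      stuffle_1_2[OF adm_pq pos_u pos_u]
      stuffle_1_3[OF adm_q pos_u pos_u pos_p]
      stuffle_2_2[OF adm_q pos_u pos_u pos_p]
      stuffle_2_2[OF adm_q pos_p pos_u pos_u]
      stuffle_3_1[OF adm_q pos_u pos_p pos_u]
    unfolding cyclic_defect4_def
    by (simp (no_asm_use) only: algebra_simps zero mult_zero_left mult_zero_right)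
qed

lemma cyclic_defect4_2121:
  assumes adm_p: "adm b p" and adm_q: "adm b q" and pos_u: "u \<ge> 1"
    and zero: "rmzv b [u] = 0" "rmzv b [u, u] = 0"
  shows "cyclic_defect4 b p u q u = 0"
proof -
  have adm_up: "adm b (u + p)"
    using assms by (auto simp: adm_def)
  have pos_p: "p \<ge> 1" and pos_q: "q \<ge> 1" and pos_uq: "u + q \<ge> 1"
    using assms by (auto simp: adm_def)
  show ?thesis
    using stuffle_1_1[OF adm_up pos_uq]
      stuffle_1_3[OF adm_p pos_u pos_q pos_u]
      stuffle_1_3[OF adm_q pos_u pos_p pos_u]
      stuffle_2_2[OF adm_p pos_u pos_u pos_q]
      stuffle_2_2[OF adm_q pos_u pos_u pos_p]
      stuffle_3_1[OF adm_p pos_u pos_q pos_u]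
      stuffle_3_1[OF adm_q pos_u pos_p pos_u]
      arg_cong[OF stuffle_1_1[OF adm_p pos_u], of "\<lambda>t. t * (rmzv b [q, u])"]
      arg_cong[OF stuffle_1_1[OF adm_p pos_u], of "\<lambda>t. t * (rmzv b [u, q])"]
      arg_cong[OF stuffle_1_1[OF adm_q pos_u], of "\<lambda>t. t * (rmzv b [u + p])"]
    unfolding cyclic_defect4_def
    by (simp (no_asm_use) only: algebra_simps zero mult_zero_left mult_zero_right)
qed

lemma cyclic_defect4_2221:
  assumes adm_p: "adm b p" and adm_q: "adm b q" and adm_r: "adm b r" and pos_u: "u \<ge> 1"
    and zero: "rmzv b [u] = 0"
  shows "cyclic_defect4 b p q r u = 0"
proof -
  have adm_pr: "adm b (p + r)" and adm_pqr: "adm b (p + q + r)"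
    using assms by (auto simp: adm_def)
  have pos_p: "p \<ge> 1" and pos_q: "q \<ge> 1" and pos_r: "r \<ge> 1" and pos_pr: "p + r \<ge> 1"
    using assms by (auto simp: adm_def)
  show ?thesis
    using stuffle_1_3[OF adm_p pos_q pos_r pos_u]
      stuffle_1_1[OF adm_pqr pos_u]
      stuffle_1_3[OF adm_q pos_u pos_p pos_r]
      stuffle_1_2[OF adm_q pos_u pos_pr]
      stuffle_1_3[OF adm_r pos_u pos_p pos_q]
      stuffle_2_2[OF adm_p pos_q pos_r pos_u]
      stuffle_2_1[OF adm_pr pos_u pos_q]
      stuffle_2_2[OF adm_q pos_r pos_u pos_p]
      stuffle_3_1[OF adm_p pos_r pos_u pos_q]
      stuffle_3_1[OF adm_q pos_r pos_p pos_u]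
      stuffle_3_1[OF adm_r pos_p pos_q pos_u]
      arg_cong[OF stuffle_1_2[OF adm_p pos_r pos_u], of "\<lambda>t. t * (rmzv b [q])"]
      arg_cong[OF stuffle_1_2[OF adm_r pos_u pos_p], of "\<lambda>t. t * (rmzv b [q])"]
      arg_cong[OF stuffle_2_1[OF adm_r pos_p pos_u], of "\<lambda>t. t * (rmzv b [q])"]
    unfolding cyclic_defect4_def
    by (simp (no_asm_use) only: algebra_simps zero mult_zero_left mult_zero_right)
qed

lemma cyclic_defect4_2222:
  assumes adm_p: "adm b p" and adm_q: "adm b q" and adm_r: "adm b r" and adm_s: "adm b s"
  shows "cyclic_defect4 b p q r s = 0"
proof -
  have adm_pq: "adm b (p + q)" and adm_ps: "adm b (p + s)"
    using assms by (auto simp: adm_def)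
  have pos_p: "p \<ge> 1" and pos_q: "q \<ge> 1" and pos_r: "r \<ge> 1" and pos_s: "s \<ge> 1" and pos_pq: "p + q \<ge> 1" and pos_qr: "q + r \<ge> 1"
    using assms by (auto simp: adm_def)
  show ?thesis
    using stuffle_1_3[OF adm_p pos_q pos_r pos_s]
      stuffle_1_2[OF adm_pq pos_r pos_s]
      stuffle_1_1[OF adm_ps pos_qr]
      stuffle_1_3[OF adm_q pos_r pos_s pos_p]
      stuffle_1_3[OF adm_r pos_s pos_p pos_q]
      stuffle_2_1[OF adm_p pos_qr pos_s]
      stuffle_2_1[OF adm_p pos_s pos_qr]
      stuffle_2_2[OF adm_q pos_p pos_r pos_s]
      stuffle_2_1[OF adm_r pos_pq pos_s]
      stuffle_2_2[OF adm_r pos_q pos_s pos_p]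
      stuffle_3_1[OF adm_r pos_q pos_p pos_s]
      arg_cong[OF stuffle_1_1[OF adm_p pos_q], of "\<lambda>t. t * (rmzv b [r, s])"]
      arg_cong[OF stuffle_1_2[OF adm_p pos_r pos_q], of "\<lambda>t. t * (rmzv b [s])"]
      arg_cong[OF stuffle_1_1[OF adm_p pos_s], of "\<lambda>t. t * (rmzv b [q + r])"]
      arg_cong[OF stuffle_1_1[OF adm_q pos_r], of "\<lambda>t. t * (rmzv b [s, p])"]
      arg_cong[OF stuffle_2_1[OF adm_p pos_q pos_r], of "\<lambda>t. t * (rmzv b [s])"]
      \<comment> \<open>This relation brings in the product of all four depth-one values.\<close>
      arg_cong[OF stuffle_1_1[OF adm_q pos_r], of "\<lambda>t. t * (rmzv b [p] * rmzv b [s])"]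
    unfolding cyclic_defect4_def
    by (simp (no_asm_use) only: algebra_simps)
qed

section \<open>Case analysis on the indices equal to 1\<close>

lemma rmzv_Shuffle_ones_list:
  "rmzv Shuffle [1] = 0" "rmzv Shuffle [1, 1] = 0" "rmzv Shuffle [1, 1, 1] = 0"
  "rmzv Shuffle [1, 1, 1, 1] = 0"
  using rmzv_Shuffle_ones[of 0] rmzv_Shuffle_ones[of 1] rmzv_Shuffle_ones[of 2] rmzv_Shuffle_ones[of 3]
  by (simp_all add: numeral_2_eq_2 numeral_3_eq_3)

lemma Shuffle_eq_1_or_adm: "k \<ge> 1 \<Longrightarrow> k = 1 \<or> adm Shuffle k"
  by (auto simp: adm_def)

lemma cyclic_defect3_eq_0:
  assumes pos: "l1 \<ge> 1" "l2 \<ge> 1" "l3 \<ge> 1"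
    and not_ones: "b = Shuffle \<Longrightarrow> \<not> (l1 = 1 \<and> l2 = 1 \<and> l3 = 1)"
  shows "cyclic_defect3 b l1 l2 l3 = 0"
proof (cases b)
  case Harmonic
  then show ?thesis
    using cyclic_defect3_222 pos by (simp add: adm_def)
next
  case Shuffle
  note 211 = cyclic_defect3_211[of Shuffle _ 1, OF _ _ rmzv_Shuffle_ones_list(1,2)]
    and 221 = cyclic_defect3_221[of Shuffle _ _ 1, OF _ _ _ rmzv_Shuffle_ones_list(1)]
  \<comment> \<open>Not all indices are 1, so some index is admissible, and by rotation it may be
    taken to be the first.\<close>
  have *: "cyclic_defect3 Shuffle k1 k2 k3 = 0" if "adm Shuffle k1" "k2 \<ge> 1" "k3 \<ge> 1" for k1 k2 k3
    using Shuffle_eq_1_or_adm[OF that(2)] Shuffle_eq_1_or_adm[OF that(3)] that(1)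
      211[of k1] 221[of k1 k2] 221[of k3 k1] cyclic_defect3_222[of Shuffle k1 k2 k3]
      cyclic_defect3_rotate[of Shuffle k3 k1 k2]
    by auto
  show ?thesis
    using Shuffle not_ones Shuffle_eq_1_or_adm[OF pos(1)] Shuffle_eq_1_or_adm[OF pos(2)]
      Shuffle_eq_1_or_adm[OF pos(3)] *[of l1 l2 l3] *[of l2 l3 l1] *[of l3 l1 l2] pos
      cyclic_defect3_rotate[of Shuffle l1 l2 l3] cyclic_defect3_rotate[of Shuffle l2 l3 l1]
    by auto
qed

lemma cyclic_defect4_eq_0:
  assumes pos: "l1 \<ge> 1" "l2 \<ge> 1" "l3 \<ge> 1" "l4 \<ge> 1"
    and not_ones: "b = Shuffle \<Longrightarrow> \<not> (l1 = 1 \<and> l2 = 1 \<and> l3 = 1 \<and> l4 = 1)"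
  shows "cyclic_defect4 b l1 l2 l3 l4 = 0"
proof (cases b)
  case Harmonic
  then show ?thesis
    using cyclic_defect4_2222 pos by (simp add: adm_def)
next
  case Shuffle
  note rot = cyclic_defect4_rotate[of Shuffle]
  note 2111 = cyclic_defect4_2111[of Shuffle _ 1, OF _ _ rmzv_Shuffle_ones_list(1-3)]
    and 2211 = cyclic_defect4_2211[of Shuffle _ _ 1, OF _ _ _ rmzv_Shuffle_ones_list(1,2)]
    and 2121 = cyclic_defect4_2121[of Shuffle _ _ 1, OF _ _ _ rmzv_Shuffle_ones_list(1,2)]
    and 2221 = cyclic_defect4_2221[of Shuffle _ _ _ 1, OF _ _ _ _ rmzv_Shuffle_ones_list(1)]
  have *: "cyclic_defect4 Shuffle k1 k2 k3 k4 = 0"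
    if k: "adm Shuffle k1" "k2 \<ge> 1" "k3 \<ge> 1" "k4 \<ge> 1" for k1 k2 k3 k4
  proof -
    \<comment> \<open>With \<open>k1\<close> admissible eight patterns remain. Five are covered
      directly; the fourth, sixth and seventh become 2211, 2221 and 2221 after rotation.\<close>
    consider "k2 = 1" "k3 = 1" "k4 = 1" | "adm Shuffle k2" "k3 = 1" "k4 = 1"
      | "k2 = 1" "adm Shuffle k3" "k4 = 1" | "k2 = 1" "k3 = 1" "adm Shuffle k4"
      | "adm Shuffle k2" "adm Shuffle k3" "k4 = 1" | "adm Shuffle k2" "k3 = 1" "adm Shuffle k4"
      | "k2 = 1" "adm Shuffle k3" "adm Shuffle k4" | "adm Shuffle k2" "adm Shuffle k3" "adm Shuffle k4"
      using k(2-4)[THEN Shuffle_eq_1_or_adm] by blast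
    then show ?thesis
    proof cases
      case 4
      then show ?thesis using 2211[of k4 k1] rot[of k4 k1 k2 k3] k(1) by simp
    next
      case 6
      then show ?thesis using 2221[of k4 k1 k2] rot[of k4 k1 k2 k3] k(1) by simp
    next
      case 7
      then show ?thesis
        using 2221[of k3 k4 k1] rot[of k3 k4 k1 k2] rot[of k4 k1 k2 k3] k(1) by simp
    qed (use k(1) 2111 2211 2121 2221 cyclic_defect4_2222 in simp_all)
  qed
  show ?thesis
    using Shuffle not_ones pos[THEN Shuffle_eq_1_or_adm] pos
      *[of l1 l2 l3 l4] *[of l2 l3 l4 l1] *[of l3 l4 l1 l2] *[of l4 l1 l2 l3]
      rot[of l1 l2 l3 l4] rot[of l2 l3 l4 l1] rot[of l3 l4 l1 l2]
    by auto
qed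

text \<open>One of the two indices is admissible and may serve as the left factor; the claim is
  symmetric.\<close>

lemma cyclic2:
  assumes pos: "l1 \<ge> 1" "l2 \<ge> 1"
    and not_ones: "b = Shuffle \<Longrightarrow> \<not> (l1 = 1 \<and> l2 = 1)"
  shows "rmzv b [l1, l2] + rmzv b [l2, l1] = rmzv b [l1] * rmzv b [l2] - rmzv b [l1 + l2]"
proof -
  have "adm b l1 \<or> adm b l2"
    using assms by (cases b) (auto simp: adm_def)
  then show ?thesis
    using stuffle_1_1[of b l1 l2] stuffle_1_1[of b l2 l1] pos by (auto simp: ac_simps)
qed

theorem theorem1p1:
  fixes b :: prod_kind
  shows
    "(\<forall>l1 l2 :: nat. l1 \<ge> 1 \<and> l2 \<ge> 1 \<longrightarrow>
        rmzv b [l1, l2] + rmzv b [l2, l1]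
        = rmzv b [l1] * rmzv b [l2] - chi b [l1, l2] * mzv [l1 + l2])
   \<and> (\<forall>l1 l2 l3 :: nat. l1 \<ge> 1 \<and> l2 \<ge> 1 \<and> l3 \<ge> 1 \<longrightarrow>
        rmzv b [l1, l2, l3] + rmzv b [l2, l3, l1] + rmzv b [l3, l1, l2]
        = - (rmzv b [l1] * rmzv b [l2] * rmzv b [l3])
          + rmzv b [l1, l2] * rmzv b [l3]
          + rmzv b [l2, l3] * rmzv b [l1]
          + rmzv b [l3, l1] * rmzv b [l2]
          + chi b [l1, l2, l3] * mzv [l1 + l2 + l3])
   \<and> (\<forall>l1 l2 l3 l4 :: nat. l1 \<ge> 1 \<and> l2 \<ge> 1 \<and> l3 \<ge> 1 \<and> l4 \<ge> 1 \<longrightarrow>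
        rmzv b [l1, l2, l3, l4] + rmzv b [l2, l3, l4, l1]
          + rmzv b [l3, l4, l1, l2] + rmzv b [l4, l1, l2, l3]
        = rmzv b [l1] * rmzv b [l2] * rmzv b [l3] * rmzv b [l4]
          - rmzv b [l1, l2] * rmzv b [l3] * rmzv b [l4]
          - rmzv b [l2, l3] * rmzv b [l4] * rmzv b [l1]
          - rmzv b [l3, l4] * rmzv b [l1] * rmzv b [l2]
          - rmzv b [l4, l1] * rmzv b [l2] * rmzv b [l3]
          + rmzv b [l1, l2] * rmzv b [l3, l4]
          + rmzv b [l2, l3] * rmzv b [l4, l1]
          + rmzv b [l1, l2, l3] * rmzv b [l4]
          + rmzv b [l2, l3, l4] * rmzv b [l1]
          + rmzv b [l3, l4, l1] * rmzv b [l2]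
          + rmzv b [l4, l1, l2] * rmzv b [l3]
          - chi b [l1, l2, l3, l4] * mzv [l1 + l2 + l3 + l4])"
proof (intro conjI allI impI; (elim conjE)?)
  fix l1 l2 :: nat assume pos: "l1 \<ge> 1" "l2 \<ge> 1"
  show "rmzv b [l1, l2] + rmzv b [l2, l1]
        = rmzv b [l1] * rmzv b [l2] - chi b [l1, l2] * mzv [l1 + l2]"
  proof (cases "b = Shuffle \<and> l1 = 1 \<and> l2 = 1")
    \<comment> \<open>The exceptional case: all regularized values in the identity vanish, and so
      does \<open>chi\<close>.\<close>
    case True
    then show ?thesis
      using rmzv_Shuffle_ones_list by simp
  next
    case False
    then have "chi b [l1, l2] = 1"
      by (cases b) auto
    then show ?thesis
      using cyclic2[of l1 l2 b] pos False rmzv_single[of "l1 + l2" b] by auto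
  qed
next
  fix l1 l2 l3 :: nat assume pos: "l1 \<ge> 1" "l2 \<ge> 1" "l3 \<ge> 1"
  show "rmzv b [l1, l2, l3] + rmzv b [l2, l3, l1] + rmzv b [l3, l1, l2]
        = - (rmzv b [l1] * rmzv b [l2] * rmzv b [l3])
          + rmzv b [l1, l2] * rmzv b [l3]
          + rmzv b [l2, l3] * rmzv b [l1]
          + rmzv b [l3, l1] * rmzv b [l2]
          + chi b [l1, l2, l3] * mzv [l1 + l2 + l3]"
  proof (cases "b = Shuffle \<and> l1 = 1 \<and> l2 = 1 \<and> l3 = 1")
    case True
    then show ?thesis
      using rmzv_Shuffle_ones_list by simp
  next
    case False
    then have "chi b [l1, l2, l3] = 1"
      by (cases b) auto
    then show ?thesis
      using cyclic_defect3_eq_0[OF pos, of b] False rmzv_single[of "l1 + l2 + l3" b] pos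
      by (auto simp: cyclic_defect3_def)
  qed
next
  fix l1 l2 l3 l4 :: nat assume pos: "l1 \<ge> 1" "l2 \<ge> 1" "l3 \<ge> 1" "l4 \<ge> 1"
  show "rmzv b [l1, l2, l3, l4] + rmzv b [l2, l3, l4, l1]
          + rmzv b [l3, l4, l1, l2] + rmzv b [l4, l1, l2, l3]
        = rmzv b [l1] * rmzv b [l2] * rmzv b [l3] * rmzv b [l4]
          - rmzv b [l1, l2] * rmzv b [l3] * rmzv b [l4]
          - rmzv b [l2, l3] * rmzv b [l4] * rmzv b [l1]
          - rmzv b [l3, l4] * rmzv b [l1] * rmzv b [l2]
          - rmzv b [l4, l1] * rmzv b [l2] * rmzv b [l3]
          + rmzv b [l1, l2] * rmzv b [l3, l4]
          + rmzv b [l2, l3] * rmzv b [l4, l1]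
          + rmzv b [l1, l2, l3] * rmzv b [l4]
          + rmzv b [l2, l3, l4] * rmzv b [l1]
          + rmzv b [l3, l4, l1] * rmzv b [l2]
          + rmzv b [l4, l1, l2] * rmzv b [l3]
          - chi b [l1, l2, l3, l4] * mzv [l1 + l2 + l3 + l4]"
  proof (cases "b = Shuffle \<and> l1 = 1 \<and> l2 = 1 \<and> l3 = 1 \<and> l4 = 1")
    case True
    then show ?thesis
      using rmzv_Shuffle_ones_list by simp
  next
    case False
    then have "chi b [l1, l2, l3, l4] = 1"
      by (cases b) auto
    then show ?thesis
      using cyclic_defect4_eq_0[OF pos, of b] False rmzv_single[of "l1 + l2 + l3 + l4" b] pos
      by (auto simp: cyclic_defect4_def)
  qed
qed

end
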